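(* Let $m$ be a positive integer and let $\sigma\in\mathbb{R}$ satisfy $m-1<\sigma<m$. Assume that $r\in C^{m-1}[0,1]$ and $D_*^\sigma r\in C^{q,m-\sigma}(0,1]$ for some integer $q\ge 1$. Then $r\in C^{q+m-1}(0,1]$ and there exists a constant $C$, independent of $x$, such that for all $x\in(0,1]$ $$|r^{(i)}(x)|\le\begin{cases} C &\text{if } i=0,1,\dots,m-1,\\ Cx^{\sigma-i}&\text{if } i=m,m+1,\dots,q+m-1.\end{cases}$$
   Context: For $m-1<\sigma<m$ ($m$ a positive integer), the Riemann-Liouville fractional derivative is $$D^\sigma g(x)=\left(\frac{d}{dx}\right)^m\left[\frac{1}{\Gamma(m-\sigma)}\int_0^x(x-t)^{m-\sigma-1}g(t)\,dt\right],\quad 0<x\le 1,$$ for all $g$ for which this exists, and the Caputo fractional derivative is $D_*^\sigma g=D^\sigma[g-T_{m-1}[g;0]]$, where $T_{m-1}[g;0]$ is the Taylor polynomial of degree $m-1$ of $g$ expanded around $x=0$. For an integer $q\ge1$ and $\nu\in(-\infty,1)$, $C^{q,\nu}(0,1]$ is the set of continuous functions $y:[0,1]\to\mathbb{R}$ that are $q$ times continuously differentiable in $(0,1]$ and for which there is a constant $C$ with, for all $0<x\le1$ and $i=1,2,\dots,q$, $$|y^{(i)}(x)|\le\begin{cases}C&\text{if } i<1-\nu,\\ C(1+|\ln x|)&\text{if } i=1-\nu,\\ Cx^{1-\nu-i}&\text{if } i>1-\nu.\end{cases}$$ A function defined on $(0,1]$ (such as $D_*^\sigma r$) is said to belong to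 $C^{q,\nu}(0,1]$ if it extends continuously to $[0,1]$ and the extension belongs to $C^{q,\nu}(0,1]$. $C^k(I)$ denotes the real-valued functions whose derivatives up to order $k$ are continuous on the interval $I$. *)

theory Defs
  imports "HOL-Analysis.Analysis"
begin

text \<open>
  Iterated derivatives relative to a set: at an endpoint belonging to \<open>S\<close> the derivative is
  one-sided, and only the values of \<open>f\<close> on \<open>S\<close> matter (for points of \<open>S\<close>).
  As for \<^const>\<open>vector_derivative\<close>, the value is meaningful only where the derivative exists.
\<close>

primrec nth_deriv_on :: "nat \<Rightarrow> real set \<Rightarrow> (real \<Rightarrow> real) \<Rightarrow> real \<Rightarrow> real" where
  "nth_deriv_on 0 S f = f"
| "nth_deriv_on (Suc k) S f = (\<lambda>x. vector_derivative (nth_deriv_on k S f) (at x within S))"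

definition times_differentiable_on :: "nat \<Rightarrow> (real \<Rightarrow> real) \<Rightarrow> real set \<Rightarrow> bool" where
  "times_differentiable_on k f S \<longleftrightarrow> (\<forall>j<k. nth_deriv_on j S f differentiable_on S)"

definition C_on :: "nat \<Rightarrow> real set \<Rightarrow> (real \<Rightarrow> real) set" where
  "C_on k S = {f. times_differentiable_on k f S \<and> (\<forall>j\<le>k. continuous_on S (nth_deriv_on j S f))}"

text \<open>The space \<open>C\<^sup>q\<^sup>,\<^sup>\<nu>(0,1]\<close>, for \<open>q \<ge> 1\<close> and \<open>\<nu> < 1\<close>; only the values on \<open>[0,1]\<close> matter.\<close>

definition weighted_C :: "nat \<Rightarrow> real \<Rightarrow> (real \<Rightarrow> real) set" where
  "weighted_C q \<nu> = {y. continuous_on {0..1} y \<and> y \<in> C_on q {0<..1} \<and>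
     (\<exists>C. \<forall>x\<in>{0<..1}. \<forall>i\<in>{1..q}.
        \<bar>nth_deriv_on i {0<..1} y x\<bar> \<le>
          (if real i < 1 - \<nu> then C
           else if real i = 1 - \<nu> then C * (1 + \<bar>ln x\<bar>)
           else C * x powr (1 - \<nu> - real i)))}"

text \<open>Membership in \<open>C\<^sup>q\<^sup>,\<^sup>\<nu>(0,1]\<close> of a function defined on \<open>(0,1]\<close> only.\<close>

definition extends_to_weighted_C :: "nat \<Rightarrow> real \<Rightarrow> (real \<Rightarrow> real) \<Rightarrow> bool" where
  "extends_to_weighted_C q \<nu> f \<longleftrightarrow> (\<exists>y\<in>weighted_C q \<nu>. \<forall>x\<in>{0<..1}. y x = f x)"

text \<open>
  Riemann--Liouville and Caputo derivatives of order \<open>\<sigma>\<close>, where \<open>m - 1 < \<sigma> < m\<close>.  The integrand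
  is singular at \<open>t = x\<close>, where \<open>powr\<close> returns 0; this is a null set.
\<close>

definition RL_integral :: "nat \<Rightarrow> real \<Rightarrow> (real \<Rightarrow> real) \<Rightarrow> real \<Rightarrow> real" where
  "RL_integral m \<sigma> g x =
     1 / Gamma (real m - \<sigma>) * (LINT t:{0..x}|lebesgue. (x - t) powr (real m - \<sigma> - 1) * g t)"

definition RL_deriv :: "nat \<Rightarrow> real \<Rightarrow> (real \<Rightarrow> real) \<Rightarrow> real \<Rightarrow> real" where
  "RL_deriv m \<sigma> g = nth_deriv_on m {0<..1} (RL_integral m \<sigma> g)"

definition RL_deriv_exists :: "nat \<Rightarrow> real \<Rightarrow> (real \<Rightarrow> real) \<Rightarrow> bool" where
  "RL_deriv_exists m \<sigma> g \<longleftrightarrow>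
     (\<forall>x\<in>{0<..1}. set_integrable lebesgue {0..x} (\<lambda>t. (x - t) powr (real m - \<sigma> - 1) * g t)) \<and>
     times_differentiable_on m (RL_integral m \<sigma> g) {0<..1}"

definition taylor_poly_at_0 :: "nat \<Rightarrow> (real \<Rightarrow> real) \<Rightarrow> real \<Rightarrow> real" where
  "taylor_poly_at_0 n g x = (\<Sum>k\<le>n. nth_deriv_on k {0..1} g 0 / fact k * x ^ k)"

definition caputo_deriv :: "nat \<Rightarrow> real \<Rightarrow> (real \<Rightarrow> real) \<Rightarrow> real \<Rightarrow> real" where
  "caputo_deriv m \<sigma> g = RL_deriv m \<sigma> (\<lambda>t. g t - taylor_poly_at_0 (m - 1) g t)"

definition caputo_deriv_exists :: "nat \<Rightarrow> real \<Rightarrow> (real \<Rightarrow> real) \<Rightarrow> bool" where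
  "caputo_deriv_exists m \<sigma> g \<longleftrightarrow> RL_deriv_exists m \<sigma> (\<lambda>t. g t - taylor_poly_at_0 (m - 1) g t)"

end

theory Submission
  imports Defs
begin

text \<open>
  Write \<open>n = m - 1\<close>, \<open>b = m - \<sigma>\<close> and \<open>a = 1 - b = \<sigma> - n\<close>, both in \<open>(0,1)\<close>, and let \<open>I\<^sup>c\<close> be the
  fractional integral of order \<open>c\<close>. With \<open>g = r - T\<close>, where \<open>T\<close> is the Taylor polynomial of degree
  \<open>n\<close> of \<open>r\<close> at \<open>0\<close>, the hypothesis says that the \<open>m\<close>-th derivative of \<open>I\<^sup>b g\<close> on \<open>(0,1]\<close> is a function
  \<open>y\<close> that is continuous on \<open>[0,1]\<close> and whose \<open>i\<close>-th derivative is \<open>O(x\<^sup>-\<^sup>i)\<close> for \<open>i \<le> q\<close>.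

  The derivatives of \<open>g\<close> of order at most \<open>n\<close> vanish at \<open>0\<close>, so each of the first \<open>n\<close> of the \<open>m\<close>
  derivatives can be moved inside \<open>I\<^sup>b\<close> (\<open>frac_int_deriv\<close>). Only one is left outside: if \<open>h\<close> is the
  \<open>n\<close>-th derivative of \<open>g\<close>, that is, of \<open>r\<close> up to a constant, then \<open>(I\<^sup>b h)' = y\<close>, hence
  \<open>I\<^sup>b h = I\<^sup>1 y\<close>. Applying \<open>I\<^sup>a\<close> and the semigroup law \<open>I\<^sup>a I\<^sup>b = I\<^sup>1\<close> (\<open>frac_int_semigroup\<close>) and
  differentiating, one solves this Abel equation: \<open>h = I\<^sup>a y\<close> (\<open>abel_inversion\<close>).

  It remains to see how \<open>I\<^sup>a y\<close> behaves near \<open>0\<close>. Substituting \<open>t = x u\<close> gives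
  \<open>I\<^sup>a y (x) = x\<^sup>a / \<Gamma>(a) * (\<integral>\<^sub>0\<^sup>1 (1 - u)\<^sup>a\<^sup>-\<^sup>1 y(x u) du)\<close>, where the singularity no longer moves with \<open>x\<close>.
  The integral can therefore be differentiated under the integral sign, and each derivative costs
  at most a factor \<open>x\<^sup>-\<^sup>1\<close>; by the product rule the \<open>i\<close>-th derivative of \<open>h\<close> is \<open>O(x\<^sup>a\<^sup>-\<^sup>i)\<close>
  (\<open>smooth_order_frac_int\<close>). As \<open>a - i = \<sigma> - (n + i)\<close>, this is the bound on the derivative
  of \<open>r\<close> of order \<open>n + i\<close>.
\<close>

section \<open>The Abel kernel and the fractional integral\<close>

text \<open>
  Cutting the kernel off at \<open>0\<close> turns integrals over \<open>{0..x}\<close> into convolutions over the whole line,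
  so that Fubini's theorem and affine substitutions apply directly.
\<close>

definition abel_kernel :: "real \<Rightarrow> real \<Rightarrow> real" where
  "abel_kernel a z = (if 0 < z then z powr (a - 1) / Gamma a else 0)"

definition frac_int :: "real \<Rightarrow> (real \<Rightarrow> real) \<Rightarrow> real \<Rightarrow> real" where
  "frac_int a f x = (\<integral>t. abel_kernel a (x - t) * (indicator {0..1} t * f t) \<partial>lborel)"

lemma abel_kernel_measurable [measurable]: "abel_kernel a \<in> borel_measurable borel"
  unfolding abel_kernel_def [abs_def] by measurable

lemma abel_kernel_nonneg: "0 < a \<Longrightarrow> 0 \<le> abel_kernel a z"
  by (simp add: abel_kernel_def Gamma_real_pos less_imp_le)

lemma abel_kernel_scale:
  assumes "0 < x"
  shows "abel_kernel a (x * z) = x powr (a - 1) * abel_kernel a z"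
  using assms by (simp add: abel_kernel_def powr_mult zero_less_mult_iff)

lemma abel_kernel_one: "abel_kernel 1 z = indicator {0<..} z"
  by (simp add: abel_kernel_def indicator_def)

text \<open>
  Euler's Beta integral. The gauge integral becomes a Bochner integral because the
  integrand is nonnegative.
\<close>

lemma abel_kernel_convolution_unit:
  assumes "0 < a" "0 < b"
  shows "has_bochner_integral lborel (\<lambda>u. abel_kernel a (1 - u) * abel_kernel b u) (1 / Gamma (a + b))"
proof -
  have eq: "abel_kernel a (1 - u) * abel_kernel b u =
     (if u \<in> {0..1} then u powr (b - 1) * (1 - u) powr (a - 1) / (Gamma a * Gamma b) else 0)" for u
    by (auto simp: abel_kernel_def)
  have pos: "Gamma a \<noteq> 0" "Gamma b \<noteq> 0"
    using Gamma_real_pos[OF assms(1)] Gamma_real_pos[OF assms(2)] by simp_all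
  have "((\<lambda>u. u powr (b - 1) * (1 - u) powr (a - 1) / (Gamma a * Gamma b))
      has_integral Beta b a / (Gamma a * Gamma b)) {0..1}"
    by (intro has_integral_divide has_integral_Beta_real assms)
  then have "((\<lambda>u. abel_kernel a (1 - u) * abel_kernel b u) has_integral 1 / Gamma (a + b)) UNIV"
    unfolding eq has_integral_restrict_UNIV
    using pos by (simp add: Beta_def field_simps)
  then have "(\<integral>\<^sup>+u. ennreal (abel_kernel a (1 - u) * abel_kernel b u) \<partial>lborel) = ennreal (1 / Gamma (a + b))"
    using assms
    by (intro nn_integral_has_integral_lborel) (auto intro!: mult_nonneg_nonneg abel_kernel_nonneg)
  then show ?thesis
    using assms Gamma_real_pos[of "a + b"]
    by (intro has_bochner_integral_nn_integral AE_I2 mult_nonneg_nonneg abel_kernel_nonneg)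
       (auto simp: less_imp_le)
qed

text \<open>
  Substituting \<open>s = t + (x - t) u\<close> reduces this to the unit interval.
\<close>

lemma abel_kernel_convolution:
  assumes "0 < a" "0 < b"
  shows "has_bochner_integral lborel (\<lambda>s. abel_kernel a (x - s) * abel_kernel b (s - t)) (abel_kernel (a + b) (x - t))"
proof (cases "t < x")
  case True
  define d where "d = x - t"
  have d: "0 < d" using True by (simp add: d_def)
  have "abel_kernel a (x - (t + d * u)) * abel_kernel b (t + d * u - t)
      = d powr (a + b - 2) * (abel_kernel a (1 - u) * abel_kernel b u)" for u
  proof -
    have "x - (t + d * u) = d * (1 - u)" "t + d * u - t = d * u"
      by (auto simp: d_def algebra_simps)
    moreover have "d powr (a - 1) * d powr (b - 1) = d powr (a + b - 2)"
      by (simp flip: powr_add add: algebra_simps)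
    ultimately show ?thesis
      using d by (simp add: abel_kernel_scale mult_ac)
  qed
  moreover have "abel_kernel (a + b) (x - t) /\<^sub>R \<bar>d\<bar> = d powr (a + b - 2) * (1 / Gamma (a + b))"
  proof -
    have "d powr (a + b - 1) = d powr (a + b - 2) * d"
      using d powr_add[of d "a + b - 2" 1] by (simp add: algebra_simps)
    then show ?thesis
      unfolding d_def[symmetric] using d by (simp add: abel_kernel_def)
  qed
  ultimately show ?thesis
    using has_bochner_integral_mult_right[OF abel_kernel_convolution_unit[OF assms], of "d powr (a + b - 2)"] d
    by (subst lborel_has_bochner_integral_real_affine_iff[where c=d and t=t]) auto
next
  case False
  then have "abel_kernel a (x - s) * abel_kernel b (s - t) = 0" for s
    by (auto simp: abel_kernel_def)
  moreover have "abel_kernel (a + b) (x - t) = 0"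
    using False by (simp add: abel_kernel_def)
  ultimately show ?thesis
    by (simp only: has_bochner_integral_zero)
qed

lemma abel_kernel_integrable:
  assumes "0 < a" and [measurable]: "(\<lambda>t. indicator {0..1} t * f t) \<in> borel_measurable borel"
    and bnd: "\<And>t. t \<in> {0..1} \<Longrightarrow> \<bar>f t\<bar> \<le> M"
  shows "integrable lborel (\<lambda>t. abel_kernel a (x - t) * (indicator {0..1} t * f t))"
proof (rule Bochner_Integration.integrable_bound)
  \<comment> \<open>The kernel of order 1 is the indicator of the positive half-line: shifted to \<open>- 1\<close>, it dominates
    the indicator of \<open>{0..1}\<close>, and the product is integrable by the convolution formula.\<close>
  show "integrable lborel (\<lambda>t. M * (abel_kernel a (x - t) * abel_kernel 1 (t - (- 1))))"
    using abel_kernel_convolution[of a 1 x "- 1"] assms(1)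
    by (intro integrable_mult_right) (auto simp: has_bochner_integral_iff)
  have "\<bar>abel_kernel a (x - t) * (indicator {0..1} t * f t)\<bar>
      \<le> \<bar>M * (abel_kernel a (x - t) * abel_kernel 1 (t - (- 1)))\<bar>" for t
    using bnd[of t] abel_kernel_nonneg[OF assms(1), of "x - t"]
    by (auto simp: abel_kernel_one indicator_def abs_mult mult.commute[of M] intro!: mult_left_mono)
  then show "AE t in lborel. norm (abel_kernel a (x - t) * (indicator {0..1} t * f t))
      \<le> norm (M * (abel_kernel a (x - t) * abel_kernel 1 (t - (- 1))))"
    by (simp add: real_norm_def)
qed measurable

lemma bounded_measurable_of_continuous_on_unit:
  fixes f :: "real \<Rightarrow> real"
  assumes "continuous_on {0..1} f"
  obtains M where "(\<lambda>t. indicator {0..1} t * f t) \<in> borel_measurable borel"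
    "\<And>t. t \<in> {0..1} \<Longrightarrow> \<bar>f t\<bar> \<le> M"
proof -
  have "compact (f ` {0..1})"
    using assms by (intro compact_continuous_image) auto
  then obtain M where M: "\<And>t. t \<in> {0..1} \<Longrightarrow> \<bar>f t\<bar> \<le> M"
    by (force simp: bounded_iff dest!: compact_imp_bounded)
  show ?thesis
  proof
    show "(\<lambda>t. indicator {0..1} t * f t) \<in> borel_measurable borel"
      using borel_measurable_continuous_on_indicator[OF _ assms] by simp
  qed (use M in auto)
qed

lemma frac_int_nonpos: "x \<le> 0 \<Longrightarrow> frac_int a f x = 0"
  unfolding frac_int_def
  by (subst integral_eq_zero_AE)
     (auto simp: abel_kernel_def indicator_def)

text \<open>
  Associativity of convolution, by Fubini's theorem. The point \<open>x\<close> must not exceed \<open>1\<close>, because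
  the outer integral sees the inner one only on \<open>{0..1}\<close>.
\<close>

lemma frac_int_semigroup:
  assumes "0 < a" "0 < b" and cont: "continuous_on {0..1} f" and x: "x \<le> 1"
  shows "frac_int a (frac_int b f) x = frac_int (a + b) f x"
proof -
  obtain M where m[measurable]: "(\<lambda>t. indicator {0..1} t * f t) \<in> borel_measurable borel"
    and M: "\<And>t. t \<in> {0..1} \<Longrightarrow> \<bar>f t\<bar> \<le> M"
    using bounded_measurable_of_continuous_on_unit[OF cont] by metis
  define F where "F t = indicator {0..1} t * f t" for t
  have [measurable]: "F \<in> borel_measurable borel" using m by (simp add: F_def[abs_def])
  define H where "H t s = F t * (abel_kernel a (x - s) * abel_kernel b (s - t))" for t s
  note conv = abel_kernel_convolution[OF assms(1,2), of x, unfolded has_bochner_integral_iff]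
  have normH: "norm (H t s) = \<bar>F t\<bar> * (abel_kernel a (x - s) * abel_kernel b (s - t))" for t s
    using abel_kernel_nonneg assms(1,2) by (simp add: H_def abs_mult)
  have "integrable lborel (\<lambda>t. abel_kernel (a + b) (x - t) * F t)"
    unfolding F_def using assms(1,2) M by (intro abel_kernel_integrable m) auto
  then have "integrable lborel (\<lambda>t. norm (abel_kernel (a + b) (x - t) * F t))"
    by (rule integrable_norm)
  moreover have "norm (abel_kernel (a + b) (x - t) * F t) = (\<integral>s. norm (H t s) \<partial>lborel)" for t
    using conv abel_kernel_nonneg[of "a + b" "x - t"] assms(1,2)
    unfolding normH by (simp add: abs_mult)
  ultimately have "integrable lborel (\<lambda>t. \<integral>s. norm (H t s) \<partial>lborel)"
    by simp
  moreover have "integrable lborel (H t)" for t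
    unfolding H_def[abs_def] using conv by (intro integrable_mult_right) auto
  moreover have "(\<lambda>(t, s). H t s) \<in> borel_measurable (lborel \<Otimes>\<^sub>M lborel)"
    unfolding H_def by measurable
  ultimately have "integrable (lborel \<Otimes>\<^sub>M lborel) (\<lambda>(t, s). H t s)"
    by (intro lborel_pair.Fubini_integrable) auto
  then have fub: "(\<integral>s. (\<integral>t. H t s \<partial>lborel) \<partial>lborel) = (\<integral>t. (\<integral>s. H t s \<partial>lborel) \<partial>lborel)"
    by (rule lborel_pair.Fubini_integral)
  have "abel_kernel a (x - s) * (indicator {0..1} s * frac_int b f s) = (\<integral>t. H t s \<partial>lborel)" for s
  proof -
    have "(\<integral>t. H t s \<partial>lborel) = (\<integral>t. abel_kernel a (x - s) * (abel_kernel b (s - t) * F t) \<partial>lborel)"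
      by (simp add: H_def mult_ac)
    also have "\<dots> = abel_kernel a (x - s) * frac_int b f s"
      by (simp add: frac_int_def F_def)
    also have "\<dots> = abel_kernel a (x - s) * (indicator {0..1} s * frac_int b f s)"
      using x by (auto simp: indicator_def abel_kernel_def intro!: frac_int_nonpos)
    finally show ?thesis by simp
  qed
  then have "frac_int a (frac_int b f) x = (\<integral>s. (\<integral>t. H t s \<partial>lborel) \<partial>lborel)"
    by (simp add: frac_int_def[of a])
  also have "\<dots> = (\<integral>t. F t * abel_kernel (a + b) (x - t) \<partial>lborel)"
    unfolding fub using conv by (simp add: H_def[abs_def])
  also have "\<dots> = frac_int (a + b) f x"
    by (simp add: frac_int_def F_def mult.commute)
  finally show ?thesis .
qed

text \<open>
  This form has a fixed kernel, whose singularity stays at \<open>u = 1\<close>; regularity in \<open>x\<close> is then inherited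
  from that of \<open>f\<close>, while the factor \<open>x powr a\<close> carries the behaviour at \<open>0\<close>.
\<close>

lemma frac_int_dilation:
  assumes "0 < a" "0 \<le> x" "x \<le> 1"
  shows "frac_int a f x = x powr a * frac_int a (\<lambda>u. f (x * u)) 1"
proof (cases "x = 0")
  case True
  then show ?thesis by (simp add: frac_int_nonpos)
next
  case False
  with assms have x: "0 < x" by simp
  have eq: "abel_kernel a (x - x * u) * (indicator {0..1} (x * u) * f (x * u)) =
     x powr (a - 1) * (abel_kernel a (1 - u) * (indicator {0..1} u * f (x * u)))" for u
  proof (cases "u < 1")
    case True
    have "abel_kernel a (x - x * u) = x powr (a - 1) * abel_kernel a (1 - u)"
      using abel_kernel_scale[OF x, of a "1 - u"] by (simp add: algebra_simps)
    moreover have "indicator {0..1} (x * u) = (indicator {0..1} u :: real)"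
      using True x assms(3) mult_le_one[of x u] by (auto simp: indicator_def zero_le_mult_iff)
    ultimately show ?thesis by simp
  next
    case False
    with x show ?thesis by (simp add: abel_kernel_def)
  qed
  have "frac_int a f x = x * (\<integral>u. abel_kernel a (x - x * u) * (indicator {0..1} (x * u) * f (x * u)) \<partial>lborel)"
    unfolding frac_int_def using x by (subst lborel_integral_real_affine[where c=x and t=0]) auto
  also have "\<dots> = x * (x powr (a - 1) * frac_int a (\<lambda>u. f (x * u)) 1)"
    unfolding eq frac_int_def by simp
  also have "\<dots> = x powr a * frac_int a (\<lambda>u. f (x * u)) 1"
    using x by (simp add: powr_diff)
  finally show ?thesis .
qed

section \<open>Towers of derivatives\<close>

text \<open>
  A sequence \<open>D\<close> whose members are successive derivatives is easier to build than the iterated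
  \<^const>\<open>vector_derivative\<close>, and it determines the latter where derivatives within \<open>S\<close> are unique.
\<close>

lemma derivative_tower_nth_deriv_on:
  assumes S: "\<And>x. x \<in> S \<Longrightarrow> at x within S \<noteq> bot"
    and D: "\<And>k x. k < n \<Longrightarrow> x \<in> S \<Longrightarrow> (D k has_real_derivative D (Suc k) x) (at x within S)"
    and D0: "\<And>x. x \<in> S \<Longrightarrow> D 0 x = f x"
  shows "k \<le> n \<Longrightarrow> x \<in> S \<Longrightarrow> nth_deriv_on k S f x = D k x"
proof (induction k arbitrary: x)
  case 0
  then show ?case using D0 by simp
next
  case (Suc k)
  have "(D k has_vector_derivative D (Suc k) x) (at x within S)"
    using D[of k x] Suc.prems by (simp add: has_real_derivative_iff_has_vector_derivative)
  then have "(nth_deriv_on k S f has_vector_derivative D (Suc k) x) (at x within S)"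
    by (rule has_vector_derivative_transform[rotated 2]) (use Suc in simp_all)
  then show ?case
    using S[of x] Suc.prems by (simp add: vector_derivative_within)
qed

lemma derivative_tower_times_differentiable_on:
  assumes S: "\<And>x. x \<in> S \<Longrightarrow> at x within S \<noteq> bot"
    and D: "\<And>k x. k < n \<Longrightarrow> x \<in> S \<Longrightarrow> (D k has_real_derivative D (Suc k) x) (at x within S)"
    and D0: "\<And>x. x \<in> S \<Longrightarrow> D 0 x = f x"
  shows "times_differentiable_on n f S"
  unfolding times_differentiable_on_def
proof (intro allI impI)
  fix k assume k: "k < n"
  have "D k differentiable_on S"
    unfolding differentiable_on_def
    using D[OF k] by (auto simp: real_differentiable_def)
  moreover have "nth_deriv_on k S f x = D k x" if "x \<in> S" for x
    using derivative_tower_nth_deriv_on[of S n D f k x] S D D0 k that by simp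
  ultimately show "nth_deriv_on k S f differentiable_on S"
    unfolding differentiable_on_def
  proof (intro ballI)
    fix x assume A: "\<forall>x\<in>S. D k differentiable at x within S"
      and eq: "\<And>x. x \<in> S \<Longrightarrow> nth_deriv_on k S f x = D k x" and x: "x \<in> S"
    show "nth_deriv_on k S f differentiable at x within S"
      by (rule differentiable_transform_within[OF A[rule_format, OF x] zero_less_one x]) (simp add: eq)
  qed
qed

lemma derivative_tower_C_on:
  assumes S: "\<And>x. x \<in> S \<Longrightarrow> at x within S \<noteq> bot"
    and D: "\<And>k x. k < n \<Longrightarrow> x \<in> S \<Longrightarrow> (D k has_real_derivative D (Suc k) x) (at x within S)"
    and D0: "\<And>x. x \<in> S \<Longrightarrow> D 0 x = f x"
    and Dn: "continuous_on S (D n)"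
  shows "f \<in> C_on n S"
proof -
  have "continuous_on S (D k)" if "k \<le> n" for k
  proof (cases "k = n")
    case True
    then show ?thesis using Dn by simp
  next
    case False
    then show ?thesis
      using D[of k] that by (intro DERIV_continuous_on[where D="D (Suc k)"]) auto
  qed
  moreover have "nth_deriv_on k S f x = D k x" if "x \<in> S" "k \<le> n" for x k
    using derivative_tower_nth_deriv_on[of S n D f k x] S D D0 that by simp
  ultimately have "continuous_on S (nth_deriv_on k S f)" if "k \<le> n" for k
    using that by (subst continuous_on_cong[OF refl, where g="D k"]) auto
  then show ?thesis
    using derivative_tower_times_differentiable_on[of S n D f] S D D0 by (simp add: C_on_def)
qed

lemma times_differentiable_onD:
  assumes "times_differentiable_on n f S" "k < n" "x \<in> S"
  shows "(nth_deriv_on k S f has_real_derivative nth_deriv_on (Suc k) S f x) (at x within S)"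
  using assms
  by (simp add: times_differentiable_on_def differentiable_on_def
      has_real_derivative_iff_has_vector_derivative flip: vector_derivative_works)

section \<open>Functions whose derivatives grow like powers at 0\<close>

text \<open>
  The functions on \<open>(0,1]\<close> whose \<open>i\<close>-th derivative is \<open>O(x powr (\<gamma> - i))\<close> for all \<open>i \<le> n\<close>. In the recursive
  form a derivative lowers both indices by one, so closure under products is an induction on \<open>n\<close>
  instead of an estimate of the general Leibniz formula.
\<close>

primrec smooth_order :: "nat \<Rightarrow> real \<Rightarrow> (real \<Rightarrow> real) \<Rightarrow> bool" where
  "smooth_order 0 \<gamma> f \<longleftrightarrow>
     continuous_on {0<..1} f \<and> (\<exists>C. \<forall>x\<in>{0<..1}. \<bar>f x\<bar> \<le> C * x powr \<gamma>)"
| "smooth_order (Suc n) \<gamma> f \<longleftrightarrow>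
     (\<exists>C. \<forall>x\<in>{0<..1}. \<bar>f x\<bar> \<le> C * x powr \<gamma>) \<and>
     (\<exists>f'. (\<forall>x\<in>{0<..1}. (f has_real_derivative f' x) (at x within {0<..1})) \<and>
           smooth_order n (\<gamma> - 1) f')"

lemma smooth_order_bound:
  assumes "smooth_order n \<gamma> f"
  obtains C where "0 \<le> C" "\<And>x. x \<in> {0<..1} \<Longrightarrow> \<bar>f x\<bar> \<le> C * x powr \<gamma>"
proof -
  obtain C where C: "\<forall>x\<in>{0<..1}. \<bar>f x\<bar> \<le> C * x powr \<gamma>"
    using assms by (cases n) auto
  moreover from this have "0 \<le> C"
    using C[rule_format, of 1] by simp
  ultimately show ?thesis using that by blast
qed

lemma smooth_order_SucE:
  assumes "smooth_order (Suc n) \<gamma> f"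
  obtains f' where "\<And>x. x \<in> {0<..1} \<Longrightarrow> (f has_real_derivative f' x) (at x within {0<..1})"
    "smooth_order n (\<gamma> - 1) f'"
  using assms unfolding smooth_order.simps by blast

lemma smooth_order_SucI:
  assumes "\<And>x. x \<in> {0<..1} \<Longrightarrow> \<bar>f x\<bar> \<le> C * x powr \<gamma>"
    and "\<And>x. x \<in> {0<..1} \<Longrightarrow> (f has_real_derivative f' x) (at x within {0<..1})"
    and "smooth_order n (\<gamma> - 1) f'"
  shows "smooth_order (Suc n) \<gamma> f"
  using assms unfolding smooth_order.simps by blast

lemma smooth_order_0I:
  assumes "continuous_on {0<..1} f" and "\<And>x. x \<in> {0<..1} \<Longrightarrow> \<bar>f x\<bar> \<le> C * x powr \<gamma>"
  shows "smooth_order 0 \<gamma> f"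
  using assms unfolding smooth_order.simps by blast

lemma smooth_order_continuous: "smooth_order n \<gamma> f \<Longrightarrow> continuous_on {0<..1} f"
proof (cases n)
  case (Suc m)
  assume "smooth_order n \<gamma> f"
  then have "smooth_order (Suc m) \<gamma> f" using Suc by simp
  then obtain f' where "\<And>x. x \<in> {0<..1} \<Longrightarrow> (f has_real_derivative f' x) (at x within {0<..1})"
    using smooth_order_SucE by metis
  then show ?thesis by (rule DERIV_continuous_on)
qed simp

lemma smooth_order_mono: "smooth_order (Suc n) \<gamma> f \<Longrightarrow> smooth_order n \<gamma> f"
proof (induction n arbitrary: \<gamma> f)
  case 0
  obtain C where "\<And>x. x \<in> {0<..1} \<Longrightarrow> \<bar>f x\<bar> \<le> C * x powr \<gamma>"
    using smooth_order_bound[OF 0] by metis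
  with smooth_order_continuous[OF 0] show ?case by (rule smooth_order_0I)
next
  case (Suc n)
  obtain f' where f':
      "\<And>x. x \<in> {0<..1} \<Longrightarrow> (f has_real_derivative f' x) (at x within {0<..1})"
      "smooth_order (Suc n) (\<gamma> - 1) f'" using smooth_order_SucE[OF Suc.prems] by metis
  obtain C where "\<And>x. x \<in> {0<..1} \<Longrightarrow> \<bar>f x\<bar> \<le> C * x powr \<gamma>"
    using smooth_order_bound[OF Suc.prems] by metis
  then show ?case
    using f'(1) Suc.IH[OF f'(2)] by (rule smooth_order_SucI)
qed

lemma smooth_order_cong:
  assumes "smooth_order n \<gamma> f" and eq: "\<And>x. x \<in> {0<..1} \<Longrightarrow> g x = f x"
  shows "smooth_order n \<gamma> g"
proof (cases n)
  case 0
  moreover have "continuous_on {0<..1} g \<longleftrightarrow> continuous_on {0<..1} f"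
    by (intro continuous_on_cong eq) auto
  ultimately show ?thesis
    using assms by simp
next
  case (Suc m)
  with assms(1) have Sm: "smooth_order (Suc m) \<gamma> f" by simp
  then obtain f' where f':
      "\<And>x. x \<in> {0<..1} \<Longrightarrow> (f has_real_derivative f' x) (at x within {0<..1})"
      "smooth_order m (\<gamma> - 1) f'" using smooth_order_SucE by metis
  obtain C where C: "\<And>x. x \<in> {0<..1} \<Longrightarrow> \<bar>f x\<bar> \<le> C * x powr \<gamma>"
    using smooth_order_bound[OF Sm] by metis
  have "(g has_real_derivative f' x) (at x within {0<..1})" if "x \<in> {0<..1}" for x
    using f'(1)[OF that] by (rule has_field_derivative_transform_within[OF _ zero_less_one that]) (simp add: eq)
  with C f'(2) show ?thesis
    unfolding Suc by (intro smooth_order_SucI[where f'=f']) (auto simp: eq)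
qed

lemma smooth_order_add:
  "smooth_order n \<gamma> f \<Longrightarrow> smooth_order n \<gamma> g \<Longrightarrow> smooth_order n \<gamma> (\<lambda>x. f x + g x)"
proof (induction n arbitrary: \<gamma> f g)
  case (Suc n)
  obtain C where C: "\<And>x. x \<in> {0<..1} \<Longrightarrow> \<bar>f x\<bar> \<le> C * x powr \<gamma>"
    using smooth_order_bound[OF Suc.prems(1)] by metis
  obtain D where D: "\<And>x. x \<in> {0<..1} \<Longrightarrow> \<bar>g x\<bar> \<le> D * x powr \<gamma>"
    using smooth_order_bound[OF Suc.prems(2)] by metis
  have "\<bar>f x + g x\<bar> \<le> (C + D) * x powr \<gamma>" if "x \<in> {0<..1}" for x
    using C[OF that] D[OF that] by (simp add: distrib_right)
  moreover obtain f' where f':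
      "\<And>x. x \<in> {0<..1} \<Longrightarrow> (f has_real_derivative f' x) (at x within {0<..1})"
      "smooth_order n (\<gamma> - 1) f'" using smooth_order_SucE[OF Suc.prems(1)] by metis
  moreover obtain g' where g':
      "\<And>x. x \<in> {0<..1} \<Longrightarrow> (g has_real_derivative g' x) (at x within {0<..1})"
      "smooth_order n (\<gamma> - 1) g'" using smooth_order_SucE[OF Suc.prems(2)] by metis
  moreover have "((\<lambda>x. f x + g x) has_real_derivative f' x + g' x) (at x within {0<..1})"
    if "x \<in> {0<..1}" for x
    using that by (intro derivative_intros f' g') auto
  ultimately show ?case
    using Suc.IH[of "\<gamma> - 1" f' g'] by (intro smooth_order_SucI[where f'="\<lambda>x. f' x + g' x"])
next
  case 0
  obtain C where C: "\<And>x. x \<in> {0<..1} \<Longrightarrow> \<bar>f x\<bar> \<le> C * x powr \<gamma>"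
    using smooth_order_bound[OF 0(1)] by metis
  obtain D where D: "\<And>x. x \<in> {0<..1} \<Longrightarrow> \<bar>g x\<bar> \<le> D * x powr \<gamma>"
    using smooth_order_bound[OF 0(2)] by metis
  have "\<bar>f x + g x\<bar> \<le> (C + D) * x powr \<gamma>" if "x \<in> {0<..1}" for x
    using C[OF that] D[OF that] by (simp add: distrib_right)
  moreover have "continuous_on {0<..1} (\<lambda>x. f x + g x)"
    using 0 by (intro continuous_on_add) (auto dest: smooth_order_continuous)
  ultimately show ?case by (intro smooth_order_0I)
qed

lemma smooth_order_mult:
  "smooth_order n \<gamma> f \<Longrightarrow> smooth_order n \<delta> g \<Longrightarrow> smooth_order n (\<gamma> + \<delta>) (\<lambda>x. f x * g x)"
proof (induction n arbitrary: \<gamma> \<delta> f g)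
  case (Suc n)
  obtain C where C: "0 \<le> C" "\<And>x. x \<in> {0<..1} \<Longrightarrow> \<bar>f x\<bar> \<le> C * x powr \<gamma>"
    using smooth_order_bound[OF Suc.prems(1)] by metis
  obtain D where D: "0 \<le> D" "\<And>x. x \<in> {0<..1} \<Longrightarrow> \<bar>g x\<bar> \<le> D * x powr \<delta>"
    using smooth_order_bound[OF Suc.prems(2)] by metis
  have "\<bar>f x * g x\<bar> \<le> (C * D) * x powr (\<gamma> + \<delta>)" if "x \<in> {0<..1}" for x
    using mult_mono[OF C(2)[OF that] D(2)[OF that]] C(1) by (simp add: abs_mult powr_add mult_ac)
  moreover obtain f' where f':
      "\<And>x. x \<in> {0<..1} \<Longrightarrow> (f has_real_derivative f' x) (at x within {0<..1})"
      "smooth_order n (\<gamma> - 1) f'" using smooth_order_SucE[OF Suc.prems(1)] by metis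
  moreover obtain g' where g':
      "\<And>x. x \<in> {0<..1} \<Longrightarrow> (g has_real_derivative g' x) (at x within {0<..1})"
      "smooth_order n (\<delta> - 1) g'" using smooth_order_SucE[OF Suc.prems(2)] by metis
  moreover have "((\<lambda>x. f x * g x) has_real_derivative f' x * g x + f x * g' x) (at x within {0<..1})"
    if "x \<in> {0<..1}" for x
    using DERIV_mult[OF f'(1)[OF that] g'(1)[OF that]] by (simp add: algebra_simps)
  moreover have "smooth_order n (\<gamma> + \<delta> - 1) (\<lambda>x. f' x * g x + f x * g' x)"
    using Suc.IH[OF f'(2) smooth_order_mono[OF Suc.prems(2)]]
      Suc.IH[OF smooth_order_mono[OF Suc.prems(1)] g'(2)]
    by (intro smooth_order_add) (simp_all add: algebra_simps)
  ultimately show ?case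
    by (intro smooth_order_SucI[where f'="\<lambda>x. f' x * g x + f x * g' x"])
next
  case 0
  obtain C where C: "0 \<le> C" "\<And>x. x \<in> {0<..1} \<Longrightarrow> \<bar>f x\<bar> \<le> C * x powr \<gamma>"
    using smooth_order_bound[OF 0(1)] by metis
  obtain D where D: "0 \<le> D" "\<And>x. x \<in> {0<..1} \<Longrightarrow> \<bar>g x\<bar> \<le> D * x powr \<delta>"
    using smooth_order_bound[OF 0(2)] by metis
  have "\<bar>f x * g x\<bar> \<le> (C * D) * x powr (\<gamma> + \<delta>)" if "x \<in> {0<..1}" for x
    using mult_mono[OF C(2)[OF that] D(2)[OF that]] C(1) by (simp add: abs_mult powr_add mult_ac)
  moreover have "continuous_on {0<..1} (\<lambda>x. f x * g x)"
    using 0 by (intro continuous_on_mult) (auto dest: smooth_order_continuous)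
  ultimately show ?case by (intro smooth_order_0I)
qed

lemma smooth_order_powr: "smooth_order n \<gamma> (\<lambda>x. c * x powr \<gamma>)"
proof (induction n arbitrary: \<gamma> c)
  case 0
  have "continuous_on {0<..1} (\<lambda>x. c * x powr \<gamma>)"
    by (intro continuous_intros) auto
  then show ?case by (auto simp: abs_mult intro!: exI[of _ "\<bar>c\<bar>"])
next
  case (Suc n)
  have "((\<lambda>x. c * x powr \<gamma>) has_real_derivative (c * \<gamma>) * x powr (\<gamma> - 1)) (at x within {0<..1})"
    if "x \<in> {0<..1}" for x
    using that DERIV_cmult[OF has_real_derivative_powr[of x \<gamma>], of c]
    by (auto simp: mult.assoc intro: has_field_derivative_at_within)
  then show ?case
    using Suc.IH[of "\<gamma> - 1" "c * \<gamma>"]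
    by (intro smooth_order_SucI[where C="\<bar>c\<bar>" and f'="\<lambda>x. (c * \<gamma>) * x powr (\<gamma> - 1)"])
       (auto simp: abs_mult)
qed

text \<open>
  The link between the recursive description and the iterated derivatives of the theorem.
\<close>

lemma smooth_order_iff_tower:
  "smooth_order n \<gamma> f \<longleftrightarrow>
     (\<exists>D. D 0 = f \<and> continuous_on {0<..1} (D n) \<and>
       (\<forall>k<n. \<forall>x\<in>{0<..1}. (D k has_real_derivative D (Suc k) x) (at x within {0<..1})) \<and>
       (\<forall>k\<le>n. \<exists>C. \<forall>x\<in>{0<..1}. \<bar>D k x\<bar> \<le> C * x powr (\<gamma> - real k)))"
  (is "_ \<longleftrightarrow> (\<exists>D. ?T n \<gamma> f D)")
proof (induction n arbitrary: \<gamma> f)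
  case 0
  show ?case by (auto intro!: exI[of _ "\<lambda>_. f"])
next
  case (Suc n)
  show ?case
  proof
    assume L: "smooth_order (Suc n) \<gamma> f"
    obtain f' where f':
      "\<And>x. x \<in> {0<..1} \<Longrightarrow> (f has_real_derivative f' x) (at x within {0<..1})"
      "smooth_order n (\<gamma> - 1) f'" using smooth_order_SucE[OF L] by metis
    obtain C where C: "\<And>x. x \<in> {0<..1} \<Longrightarrow> \<bar>f x\<bar> \<le> C * x powr \<gamma>"
      using smooth_order_bound[OF L] by metis
    from f'(2) obtain D where D0: "D 0 = f'" and cont: "continuous_on {0<..1} (D n)"
      and deriv: "\<And>k x. k < n \<Longrightarrow> x \<in> {0<..1} \<Longrightarrow> (D k has_real_derivative D (Suc k) x) (at x within {0<..1})"
      and bound: "\<And>k. k \<le> n \<Longrightarrow> \<exists>C. \<forall>x\<in>{0<..1}. \<bar>D k x\<bar> \<le> C * x powr (\<gamma> - 1 - real k)"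
      unfolding Suc.IH by blast
    define E where "E = case_nat f D"
    have E: "E 0 = f" "E (Suc k) = D k" for k by (simp_all add: E_def)
    have derivE: "(E k has_real_derivative E (Suc k) x) (at x within {0<..1})"
      if "k < Suc n" "x \<in> {0<..1}" for k x
    proof (cases k)
      case 0
      then show ?thesis using f'(1)[OF that(2)] by (simp add: E D0)
    next
      case (Suc j)
      then show ?thesis using deriv[of j x] that by (simp add: E)
    qed
    have boundE: "\<exists>C. \<forall>x\<in>{0<..1}. \<bar>E k x\<bar> \<le> C * x powr (\<gamma> - real k)" if "k \<le> Suc n" for k
    proof (cases k)
      case 0
      then show ?thesis using C by (intro exI[of _ C]) (simp add: E)
    next
      case (Suc j)
      have "\<exists>C. \<forall>x\<in>{0<..1}. \<bar>D j x\<bar> \<le> C * x powr (\<gamma> - 1 - real j)"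
        using that Suc by (intro bound) simp
      then show ?thesis by (simp add: E Suc diff_diff_eq)
    qed
    have "continuous_on {0<..1} (E (Suc n))"
      unfolding E(2) by (rule cont)
    then have "?T (Suc n) \<gamma> f E"
      by (intro conjI allI impI ballI E(1) derivE boundE)
    then show "\<exists>D. ?T (Suc n) \<gamma> f D" by (rule exI[of _ E])
  next
    assume "\<exists>D. ?T (Suc n) \<gamma> f D"
    then obtain D where D: "?T (Suc n) \<gamma> f D" ..
    then have D0: "D 0 = f" and cont: "continuous_on {0<..1} (D (Suc n))"
      and deriv: "\<And>k x. k < Suc n \<Longrightarrow> x \<in> {0<..1} \<Longrightarrow> (D k has_real_derivative D (Suc k) x) (at x within {0<..1})"
      and bound: "\<And>k. k \<le> Suc n \<Longrightarrow> \<exists>C. \<forall>x\<in>{0<..1}. \<bar>D k x\<bar> \<le> C * x powr (\<gamma> - real k)"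
      by blast+
    have "\<exists>C. \<forall>x\<in>{0<..1}. \<bar>D (Suc k) x\<bar> \<le> C * x powr (\<gamma> - 1 - real k)" if "k \<le> n" for k
      using bound[of "Suc k"] that by (simp add: diff_diff_eq)
    then have "?T n (\<gamma> - 1) (D 1) (\<lambda>k. D (Suc k))"
      by (intro conjI allI impI ballI cont deriv) (simp_all only: One_nat_def Suc_less_eq)
    then have "smooth_order n (\<gamma> - 1) (D 1)"
      unfolding Suc.IH by (rule exI[of _ "\<lambda>k. D (Suc k)"])
    moreover obtain C where C: "\<forall>x\<in>{0<..1}. \<bar>f x\<bar> \<le> C * x powr (\<gamma> - real 0)"
      using bound[of 0] D0 by auto
    moreover have "(f has_real_derivative D 1 x) (at x within {0<..1})" if "x \<in> {0<..1}" for x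
      using deriv[of 0 x] that D0 by simp
    ultimately show "smooth_order (Suc n) \<gamma> f"
      by (intro smooth_order_SucI[where C=C and f'="D 1"]) simp_all
  qed
qed

section \<open>Dominated convergence for the fractional integral at 1\<close>

text \<open>
  Continuity is required on the open interval only, since the functions \<open>u \<mapsto> f (x * u)\<close> of interest may be
  singular at \<open>u = 0\<close>; the two end points do not affect measurability.
\<close>

lemma unit_indicator_measurable:
  fixes F :: "real \<Rightarrow> real"
  assumes "continuous_on {0<..<1} F"
  shows "(\<lambda>u. indicator {0..1} u * F u) \<in> borel_measurable borel"
proof -
  have [measurable]: "(\<lambda>u. indicator {0<..<1} u * F u) \<in> borel_measurable borel"
    using borel_measurable_continuous_on_indicator[OF _ assms] by simp
  have "(\<lambda>u. indicator {0<..<1} u * F u + (if u = 0 then F 0 else 0) + (if u = 1 then F 1 else 0))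
      \<in> borel_measurable borel"
    by measurable
  also have "(\<lambda>u. indicator {0<..<1} u * F u + (if u = 0 then F 0 else 0) + (if u = 1 then F 1 else 0))
      = (\<lambda>u. indicator {0..1} u * F u)"
    by (auto simp: indicator_def fun_eq_iff)
  finally show ?thesis .
qed

text \<open>
  All functions \<open>F\<close> bounded by \<open>M\<close> on \<open>(0,1)\<close> share the integrable majorant on the right. The kernel of order
  \<open>1\<close> in it is the indicator of \<open>{0<..}\<close>, which puts its integral in the form of a convolution of
  kernels.
\<close>

lemma frac_int_one_dominated:
  assumes "0 < a" and bnd: "\<And>u. u \<in> {0<..<1} \<Longrightarrow> \<bar>F u\<bar> \<le> M"
  shows "AE u in lborel. norm (abel_kernel a (1 - u) * (indicator {0..1} u * F u))
    \<le> M * (abel_kernel a (1 - u) * abel_kernel 1 (u - 0))"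
proof -
  have "AE u in lborel. u \<noteq> (0::real)"
    by (rule AE_lborel_singleton)
  then show ?thesis
  proof eventually_elim
    case (elim u)
    show ?case
    proof (cases "u \<in> {0<..<1}")
      case True
      then show ?thesis
        using bnd[OF True] abel_kernel_nonneg[OF assms(1), of "1 - u"]
        by (simp add: abel_kernel_one abs_mult mult.commute[of M] mult_left_mono)
    next
      case False
      then have "u < 0 \<or> 1 \<le> u" using elim by auto
      then show ?thesis by (auto simp: abel_kernel_def)
    qed
  qed
qed

lemma frac_int_one_dominator_integral:
  assumes "0 < a"
  shows "has_bochner_integral lborel (\<lambda>u. M * (abel_kernel a (1 - u) * abel_kernel 1 (u - 0)))
    (M * abel_kernel (a + 1) 1)"
  using abel_kernel_convolution[OF assms zero_less_one, of 1 0]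
  by (intro has_bochner_integral_mult_right) simp

lemma frac_int_one_integrable:
  assumes "0 < a" "continuous_on {0<..<1} F" "\<And>u. u \<in> {0<..<1} \<Longrightarrow> \<bar>F u\<bar> \<le> M"
  shows "integrable lborel (\<lambda>u. abel_kernel a (1 - u) * (indicator {0..1} u * F u))"
proof -
  note [measurable] = unit_indicator_measurable[OF assms(2)]
  have le_norm: "x \<le> norm y" if "x \<le> y" for x y :: real
    using that by simp
  have "AE u in lborel. norm (abel_kernel a (1 - u) * (indicator {0..1} u * F u))
      \<le> norm (M * (abel_kernel a (1 - u) * abel_kernel 1 (u - 0)))"
    by (rule eventually_mono[OF frac_int_one_dominated[of a F M, OF assms(1,3)] le_norm])
  then show ?thesis
    by (rule Bochner_Integration.integrable_bound[rotated 2])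
       (use frac_int_one_dominator_integral[OF assms(1), of M] in \<open>simp_all add: has_bochner_integral_iff\<close>)
qed

lemma frac_int_one_bound:
  assumes "0 < a" "continuous_on {0<..<1} F" "\<And>u. u \<in> {0<..<1} \<Longrightarrow> \<bar>F u\<bar> \<le> M"
  shows "\<bar>frac_int a F 1\<bar> \<le> M * abel_kernel (a + 1) 1"
proof -
  have "\<bar>frac_int a F 1\<bar> \<le> (\<integral>u. \<bar>abel_kernel a (1 - u) * (indicator {0..1} u * F u)\<bar> \<partial>lborel)"
    unfolding frac_int_def by (rule integral_abs_bound)
  also have "\<dots> \<le> (\<integral>u. M * (abel_kernel a (1 - u) * abel_kernel 1 (u - 0)) \<partial>lborel)"
    using frac_int_one_integrable[OF assms] frac_int_one_dominator_integral[OF assms(1), of M]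
      frac_int_one_dominated[of a F M, OF assms(1,3)]
    by (intro integral_mono_AE integrable_abs) (simp_all add: has_bochner_integral_iff del: abs_mult)
  also have "\<dots> = M * abel_kernel (a + 1) 1"
    using frac_int_one_dominator_integral[OF assms(1), of M] by (simp add: has_bochner_integral_iff)
  finally show ?thesis .
qed

lemma frac_int_one_tendsto:
  assumes "0 < a"
    and cont: "\<And>n. continuous_on {0<..<1} (F n)" "continuous_on {0<..<1} G"
    and bnd: "\<And>n u. u \<in> {0<..<1} \<Longrightarrow> \<bar>F n u\<bar> \<le> M"
    and lim: "\<And>u. u \<in> {0<..<1} \<Longrightarrow> (\<lambda>n. F n u) \<longlonglongrightarrow> G u"
  shows "(\<lambda>n. frac_int a (F n) 1) \<longlonglongrightarrow> frac_int a G 1"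
  unfolding frac_int_def
proof (rule integral_dominated_convergence)
  note [measurable] = unit_indicator_measurable[OF cont(1)] unit_indicator_measurable[OF cont(2)]
  show "(\<lambda>u. abel_kernel a (1 - u) * (indicator {0..1} u * G u)) \<in> borel_measurable lborel"
    by measurable
  show "(\<lambda>u. abel_kernel a (1 - u) * (indicator {0..1} u * F n u)) \<in> borel_measurable lborel" for n
    by measurable
  show "integrable lborel (\<lambda>u. M * (abel_kernel a (1 - u) * abel_kernel 1 (u - 0)))"
    using frac_int_one_dominator_integral[OF assms(1), of M] by (simp add: has_bochner_integral_iff)
  show "AE u in lborel. norm (abel_kernel a (1 - u) * (indicator {0..1} u * F n u))
      \<le> M * (abel_kernel a (1 - u) * abel_kernel 1 (u - 0))" for n
    using frac_int_one_dominated[of a "F n" M, OF assms(1) bnd] by simp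
  have "AE u in lborel. u \<noteq> (0::real)"
    by (rule AE_lborel_singleton)
  then show "AE u in lborel. (\<lambda>n. abel_kernel a (1 - u) * (indicator {0..1} u * F n u))
      \<longlonglongrightarrow> abel_kernel a (1 - u) * (indicator {0..1} u * G u)"
  proof eventually_elim
    case (elim u)
    show ?case
    proof (cases "u \<in> {0<..<1}")
      case True
      then show ?thesis by (intro tendsto_mult tendsto_const lim)
    next
      case False
      then have "u < 0 \<or> 1 \<le> u" using elim by auto
      then show ?thesis by (auto simp: abel_kernel_def)
    qed
  qed
qed

lemma frac_int_one_diff_quotient:
  assumes "0 < a" and "continuous_on {0<..<1} F" "\<And>u. u \<in> {0<..<1} \<Longrightarrow> \<bar>F u\<bar> \<le> M"
    and "continuous_on {0<..<1} G" "\<And>u. u \<in> {0<..<1} \<Longrightarrow> \<bar>G u\<bar> \<le> N"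
  shows "(frac_int a F 1 - frac_int a G 1) / h = frac_int a (\<lambda>u. (F u - G u) / h) 1"
proof -
  have "frac_int a F 1 - frac_int a G 1 =
    (\<integral>u. abel_kernel a (1 - u) * (indicator {0..1} u * F u) - abel_kernel a (1 - u) * (indicator {0..1} u * G u) \<partial>lborel)"
    unfolding frac_int_def
    using frac_int_one_integrable[OF assms(1-3)] frac_int_one_integrable[OF assms(1,4,5)]
    by (rule Bochner_Integration.integral_diff[symmetric])
  then have "(frac_int a F 1 - frac_int a G 1) / h =
    (\<integral>u. (abel_kernel a (1 - u) * (indicator {0..1} u * F u) - abel_kernel a (1 - u) * (indicator {0..1} u * G u)) / h \<partial>lborel)"
    by simp
  also have "\<dots> = frac_int a (\<lambda>u. (F u - G u) / h) 1"
    unfolding frac_int_def by (intro Bochner_Integration.integral_cong) (simp_all add: algebra_simps diff_divide_distrib)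
  finally show ?thesis .
qed

section \<open>Smoothing at 0 by the fractional integral\<close>

text \<open>
  Keeps a sequence of arguments away from the singularity at \<open>0\<close>, which yields a common majorant for
  dominated convergence.
\<close>

lemma positive_sequence_bounded_below:
  fixes X :: "nat \<Rightarrow> real"
  assumes "X \<longlonglongrightarrow> x" "0 < x" "\<And>i. 0 < X i"
  obtains d where "0 < d" "d \<le> x" "\<And>i. d \<le> X i"
proof -
  have "(\<lambda>i. inverse (X i)) \<longlonglongrightarrow> inverse x"
    using assms by (intro tendsto_inverse) auto
  then obtain K where K: "0 < K" "\<And>i. norm (inverse (X i)) \<le> K"
    using BseqE[OF convergent_imp_Bseq[OF convergentI]] by metis
  have "inverse K \<le> X i" for i
    using K(2)[of i] K(1) assms(3)[of i] by (simp add: field_simps)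
  then show ?thesis
    using K(1) assms(2) by (intro that[of "min x (inverse K)"]) (auto simp: min_le_iff_disj)
qed

lemma continuous_on_scaled_argument:
  fixes f :: "real \<Rightarrow> real"
  assumes "continuous_on {0<..1} f" "x \<in> {0<..1}"
  shows "continuous_on {0<..<1} (\<lambda>u. u ^ k * f (x * u))"
proof -
  have "(\<lambda>u. x * u) ` {0<..<1} \<subseteq> {0<..1}"
    using assms(2) mult_le_one[of x] by (auto simp: less_imp_le)
  then show ?thesis
    by (intro continuous_intros continuous_on_compose2[OF assms(1)]) auto
qed

text \<open>
  The factor \<open>u ^ k\<close> that \<open>k\<close> differentiations of \<open>f (x * u)\<close> in \<open>x\<close> produce cancels the
  singularity of \<open>\<bar>f (x * u)\<bar> \<le> C * (x * u) powr (- k)\<close> at \<open>u = 0\<close> exactly. Hence the bound is uniform in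
  \<open>u\<close> and integrable against the kernel.
\<close>

lemma scaled_argument_bound:
  assumes bnd: "\<And>x. x \<in> {0<..1} \<Longrightarrow> \<bar>f x\<bar> \<le> C * x powr (- real k)" and "0 \<le> C"
    and d: "0 < d" "d \<le> x" "x \<le> 1" and u: "u \<in> {0<..<1}"
  shows "\<bar>u ^ k * f (x * u)\<bar> \<le> C * d powr (- real k)"
proof -
  have xu: "x * u \<in> {0<..1}"
    using d u mult_le_one[of x u] by simp
  have "\<bar>u ^ k * f (x * u)\<bar> \<le> u ^ k * (C * (x * u) powr (- real k))"
    using bnd[OF xu] u by (simp add: abs_mult mult_left_mono)
  also have "\<dots> = C * x powr (- real k)"
    using u d by (simp add: powr_mult powr_minus powr_realpow field_simps)
  also have "\<dots> \<le> C * d powr (- real k)"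
    using d \<open>0 \<le> C\<close> by (intro mult_left_mono powr_mono2') auto
  finally show ?thesis .
qed

lemma frac_int_one_scaled_continuous:
  assumes a: "0 < a" and f: "smooth_order n (- real k) f"
  shows "continuous_on {0<..1} (\<lambda>x. frac_int a (\<lambda>u. u ^ k * f (x * u)) 1)"
  unfolding continuous_on_def
proof
  fix x :: real assume x: "x \<in> {0<..1}"
  note cont = smooth_order_continuous[OF f]
  obtain C where C: "0 \<le> C" "\<And>x. x \<in> {0<..1} \<Longrightarrow> \<bar>f x\<bar> \<le> C * x powr (- real k)"
    using smooth_order_bound[OF f] by metis
  show "((\<lambda>x. frac_int a (\<lambda>u. u ^ k * f (x * u)) 1) \<longlongrightarrow> frac_int a (\<lambda>u. u ^ k * f (x * u)) 1) (at x within {0<..1})"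
    unfolding tendsto_at_iff_sequentially comp_def
  proof (intro allI impI)
    fix X :: "nat \<Rightarrow> real" assume X: "\<forall>i. X i \<in> {0<..1} - {x}" "X \<longlonglongrightarrow> x"
    then have X1: "\<And>i. X i \<in> {0<..1}" by auto
    obtain d where d: "0 < d" "d \<le> x" "\<And>i. d \<le> X i"
      using positive_sequence_bounded_below[OF X(2)] x X1 by (metis greaterThanAtMost_iff)
    show "(\<lambda>i. frac_int a (\<lambda>u. u ^ k * f (X i * u)) 1) \<longlonglongrightarrow> frac_int a (\<lambda>u. u ^ k * f (x * u)) 1"
    proof (rule frac_int_one_tendsto[OF a, where M="C * d powr (- real k)"])
      show "\<bar>u ^ k * f (X i * u)\<bar> \<le> C * d powr (- real k)" if "u \<in> {0<..<1}" for i u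
        using C d(1) d(3)[of i] X1[of i] that by (intro scaled_argument_bound[where f=f]) auto
      show "(\<lambda>i. u ^ k * f (X i * u)) \<longlonglongrightarrow> u ^ k * f (x * u)" if u: "u \<in> {0<..<1}" for u
      proof -
        have 1: "x * u \<in> {0<..1}" using x u mult_le_one[of x u] by auto
        have 2: "X i * u \<in> {0<..1}" for i using X1[of i] u mult_le_one[of "X i" u] by auto
        have "(\<lambda>i. f (X i * u)) \<longlonglongrightarrow> f (x * u)"
          by (rule continuous_on_tendsto_compose[OF cont _ 1])
             (use 2 X(2) in \<open>auto intro!: tendsto_intros\<close>)
        then show ?thesis by (intro tendsto_intros)
      qed
    qed (use cont X1 x in \<open>auto intro!: continuous_on_scaled_argument\<close>)
  qed
qed

lemma frac_int_one_scaled_bound: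
  assumes a: "0 < a" and f: "smooth_order n (- real k) f"
  obtains K where "\<And>x. x \<in> {0<..1} \<Longrightarrow> \<bar>frac_int a (\<lambda>u. u ^ k * f (x * u)) 1\<bar> \<le> K * x powr (- real k)"
proof -
  note cont = smooth_order_continuous[OF f]
  obtain C where C: "0 \<le> C" "\<And>x. x \<in> {0<..1} \<Longrightarrow> \<bar>f x\<bar> \<le> C * x powr (- real k)"
    using smooth_order_bound[OF f] by metis
  have "\<bar>frac_int a (\<lambda>u. u ^ k * f (x * u)) 1\<bar> \<le> (C * abel_kernel (a + 1) 1) * x powr (- real k)"
    if x: "x \<in> {0<..1}" for x
  proof -
    have "\<bar>frac_int a (\<lambda>u. u ^ k * f (x * u)) 1\<bar> \<le> (C * x powr (- real k)) * abel_kernel (a + 1) 1"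
      using x C by (intro frac_int_one_bound a continuous_on_scaled_argument cont scaled_argument_bound[where f=f]) auto
    then show ?thesis by (simp add: mult_ac)
  qed
  then show ?thesis by (rule that)
qed

text \<open>
  Differentiation under the integral sign. By the mean value theorem the difference quotients are
  bounded by a derivative at some point of \<open>[d u, 1]\<close>, where \<open>d\<close> is a positive lower bound of the arguments;
  the bound \<open>D (d u)\<^sup>-\<^sup>k\<^sup>-\<^sup>1\<close> there is compensated by \<open>u\<^sup>k\<^sup>+\<^sup>1\<close>.
\<close>

lemma frac_int_one_scaled_deriv:
  assumes a: "0 < a" and f: "smooth_order n (- real k) f" and f': "smooth_order j (- real (Suc k)) f'"
    and deriv: "\<And>x. x \<in> {0<..1} \<Longrightarrow> (f has_real_derivative f' x) (at x within {0<..1})"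
    and x: "x \<in> {0<..1}"
  shows "((\<lambda>x. frac_int a (\<lambda>u. u ^ k * f (x * u)) 1) has_real_derivative
     frac_int a (\<lambda>u. u ^ Suc k * f' (x * u)) 1) (at x within {0<..1})"
  unfolding has_field_derivative_iff tendsto_at_iff_sequentially comp_def
proof (intro allI impI)
  note cont = smooth_order_continuous[OF f] and cont' = smooth_order_continuous[OF f']
  obtain C where C: "0 \<le> C" "\<And>x. x \<in> {0<..1} \<Longrightarrow> \<bar>f x\<bar> \<le> C * x powr (- real k)"
    using smooth_order_bound[OF f] by metis
  obtain D where D: "0 \<le> D" "\<And>x. x \<in> {0<..1} \<Longrightarrow> \<bar>f' x\<bar> \<le> D * x powr (- real (Suc k))"
    using smooth_order_bound[OF f'] by metis
  fix X :: "nat \<Rightarrow> real" assume X: "\<forall>i. X i \<in> {0<..1} - {x}" "X \<longlonglongrightarrow> x"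
  then have X1: "X i \<in> {0<..1}" and Xx: "X i \<noteq> x" for i by auto
  obtain d where d: "0 < d" "d \<le> x" "\<And>i. d \<le> X i"
    using positive_sequence_bounded_below[OF X(2)] x X1 by (metis greaterThanAtMost_iff)
  have quot: "(frac_int a (\<lambda>u. u ^ k * f (X i * u)) 1 - frac_int a (\<lambda>u. u ^ k * f (x * u)) 1) / (X i - x)
      = frac_int a (\<lambda>u. (u ^ k * f (X i * u) - u ^ k * f (x * u)) / (X i - x)) 1" for i
    by (rule frac_int_one_diff_quotient[OF a, where M="C * d powr (- real k)" and N="C * d powr (- real k)"])
       (use cont X1[of i] x C d(1,2) d(3)[of i] in \<open>auto intro!: continuous_on_scaled_argument scaled_argument_bound[where f=f]\<close>)
  show "(\<lambda>i. (frac_int a (\<lambda>u. u ^ k * f (X i * u)) 1 - frac_int a (\<lambda>u. u ^ k * f (x * u)) 1) / (X i - x))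
      \<longlonglongrightarrow> frac_int a (\<lambda>u. u ^ Suc k * f' (x * u)) 1"
    unfolding quot
  proof (rule frac_int_one_tendsto[OF a, where M="D * d powr (- real (Suc k))"])
    show "continuous_on {0<..<1} (\<lambda>u. (u ^ k * f (X i * u) - u ^ k * f (x * u)) / (X i - x))" for i
      using X1[of i] Xx[of i] x by (intro continuous_on_divide continuous_on_diff continuous_on_scaled_argument cont) auto
    show "continuous_on {0<..<1} (\<lambda>u. u ^ Suc k * f' (x * u))"
      using x by (intro continuous_on_scaled_argument cont')
    fix u :: real assume u: "u \<in> {0<..<1}"
    have in_unit: "y * u \<in> {0<..1}" if "y \<in> {0<..1}" for y
      using that u mult_le_one[of y u] by auto
    show "\<bar>(u ^ k * f (X i * u) - u ^ k * f (x * u)) / (X i - x)\<bar> \<le> D * d powr (- real (Suc k))" for i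
    proof -
      have "\<bar>f (X i * u) - f (x * u)\<bar> \<le> (D * (d * u) powr (- real (Suc k))) * \<bar>X i * u - x * u\<bar>"
      proof -
        have "norm (f (X i * u) - f (x * u)) \<le> (D * (d * u) powr (- real (Suc k))) * norm (X i * u - x * u)"
        proof (rule field_differentiable_bound[of "{d * u..1}" f f'])
          fix z assume z: "z \<in> {d * u..1}"
          have du: "0 < d * u" using d u by simp
          with z have z1: "z \<in> {0<..1}" by auto
          show "(f has_field_derivative f' z) (at z within {d * u..1})"
            by (rule has_field_derivative_subset[OF deriv[OF z1]]) (use du in auto)
          have "\<bar>f' z\<bar> \<le> D * z powr (- real (Suc k))" by (rule D(2)[OF z1])
          also have "\<dots> \<le> D * (d * u) powr (- real (Suc k))"
            using D(1) z du by (intro mult_left_mono powr_mono2') auto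
          finally show "norm (f' z) \<le> D * (d * u) powr (- real (Suc k))" by simp
        qed (use in_unit[OF x] in_unit[OF X1[of i]] d(2) d(3)[of i] u in auto)
        then show ?thesis by simp
      qed
      then have "\<bar>(u ^ k * f (X i * u) - u ^ k * f (x * u)) / (X i - x)\<bar>
          \<le> u ^ k * ((D * (d * u) powr (- real (Suc k))) * \<bar>X i * u - x * u\<bar>) / \<bar>X i - x\<bar>"
        using u by (simp add: abs_mult divide_right_mono mult_left_mono flip: right_diff_distrib)
      also have "\<bar>X i * u - x * u\<bar> = \<bar>X i - x\<bar> * u"
        using u by (simp add: abs_mult flip: left_diff_distrib)
      also have "u ^ k * ((D * (d * u) powr (- real (Suc k))) * (\<bar>X i - x\<bar> * u)) / \<bar>X i - x\<bar>
          = D * (u ^ Suc k * (d * u) powr (- real (Suc k)))"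
        using Xx[of i] by simp
      also have "u ^ Suc k * (d * u) powr (- real (Suc k)) = d powr (- real (Suc k))"
        using u d(1) by (simp add: powr_mult powr_minus powr_realpow field_simps del: of_nat_Suc power_Suc)
      finally show ?thesis .
    qed
    show "(\<lambda>i. (u ^ k * f (X i * u) - u ^ k * f (x * u)) / (X i - x)) \<longlonglongrightarrow> u ^ Suc k * f' (x * u)"
    proof -
      have "((\<lambda>y. u ^ k * f (y * u)) has_real_derivative u ^ k * (f' (x * u) * u)) (at x within {0<..1})"
      proof (rule DERIV_cmult)
        have "(f has_real_derivative f' (x * u)) (at (x * u) within (\<lambda>y. y * u) ` {0<..1})"
          using in_unit by (intro has_field_derivative_subset[OF deriv[OF in_unit[OF x]]]) auto
        moreover have "((\<lambda>y. y * u) has_real_derivative u) (at x within {0<..1})"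
          by (auto intro!: derivative_eq_intros)
        ultimately show "((\<lambda>y. f (y * u)) has_real_derivative f' (x * u) * u) (at x within {0<..1})"
          using DERIV_image_chain[of f "f' (x * u)" "\<lambda>y. y * u" x "{0<..1}" u] by (simp add: comp_def)
      qed
      then show ?thesis
        unfolding has_field_derivative_iff tendsto_at_iff_sequentially comp_def
        using X by (simp add: mult_ac)
    qed
  qed
qed

text \<open>
  Carrying the factor \<open>u ^ k\<close> makes the statement stable under differentiation: it is replaced by the same
  statement for \<open>f'\<close> and \<open>k + 1\<close>.
\<close>

lemma smooth_order_frac_int_one_scaled:
  assumes a: "0 < a"
  shows "smooth_order n (- real k) f \<Longrightarrow>
    smooth_order n (- real k) (\<lambda>x. frac_int a (\<lambda>u. u ^ k * f (x * u)) 1)"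
proof (induction n arbitrary: k f)
  case 0
  obtain K where "\<And>x. x \<in> {0<..1} \<Longrightarrow> \<bar>frac_int a (\<lambda>u. u ^ k * f (x * u)) 1\<bar> \<le> K * x powr (- real k)"
    using frac_int_one_scaled_bound[OF a 0] by metis
  then show ?case
    by (intro smooth_order_0I frac_int_one_scaled_continuous[OF a 0])
next
  case (Suc n)
  obtain f' where f': "\<And>x. x \<in> {0<..1} \<Longrightarrow> (f has_real_derivative f' x) (at x within {0<..1})"
    "smooth_order n (- real k - 1) f'"
    using smooth_order_SucE[OF Suc.prems] by metis
  have k: "- real k - 1 = - real (Suc k)" by simp
  note so = f'(2)[unfolded k]
  obtain K where "\<And>x. x \<in> {0<..1} \<Longrightarrow> \<bar>frac_int a (\<lambda>u. u ^ k * f (x * u)) 1\<bar> \<le> K * x powr (- real k)"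
    using frac_int_one_scaled_bound[OF a Suc.prems] by metis
  then show ?case
  proof (rule smooth_order_SucI)
    show "smooth_order n (- real k - 1) (\<lambda>x. frac_int a (\<lambda>u. u ^ Suc k * f' (x * u)) 1)"
      unfolding k by (rule Suc.IH[OF so])
    show "((\<lambda>x. frac_int a (\<lambda>u. u ^ k * f (x * u)) 1) has_real_derivative
        frac_int a (\<lambda>u. u ^ Suc k * f' (x * u)) 1) (at x within {0<..1})" if "x \<in> {0<..1}" for x
      by (rule frac_int_one_scaled_deriv[OF a Suc.prems so f'(1) that])
  qed
qed

text \<open>
  By dilation, \<open>frac_int a f\<close> is the product of \<open>x powr a\<close> with a function of the same order \<open>0\<close> as \<open>f\<close>.
\<close>

lemma smooth_order_frac_int:
  assumes "0 < a" "smooth_order n 0 f"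
  shows "smooth_order n a (frac_int a f)"
proof -
  have "smooth_order n 0 (\<lambda>x. frac_int a (\<lambda>u. f (x * u)) 1)"
    using smooth_order_frac_int_one_scaled[OF assms(1), of n 0 f] assms(2) by simp
  from smooth_order_mult[OF smooth_order_powr[of n a 1] this]
  have "smooth_order n a (\<lambda>x. x powr a * frac_int a (\<lambda>u. f (x * u)) 1)" by simp
  then show ?thesis
    by (rule smooth_order_cong) (rule frac_int_dilation, use assms(1) in auto)
qed

section \<open>Calculus of the fractional integral and Abel inversion\<close>

lemma frac_int_cong:
  "(\<And>t. t \<in> {0..1} \<Longrightarrow> f t = g t) \<Longrightarrow> frac_int a f x = frac_int a g x"
  unfolding frac_int_def by (intro Bochner_Integration.integral_cong) (auto simp: indicator_def)

lemma frac_int_continuous: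
  assumes a: "0 < a" and cont: "continuous_on {0..1} f"
  shows "continuous_on {0..1} (frac_int a f)"
proof -
  obtain M where M: "\<And>t. t \<in> {0..1} \<Longrightarrow> \<bar>f t\<bar> \<le> M"
    using bounded_measurable_of_continuous_on_unit[OF cont] by metis
  have unit: "x * u \<in> {0..1}" if "x \<in> {0..1}" "u \<in> {0<..<1}" for x u :: real
    using that mult_le_one[of x u] by auto
  have contx: "continuous_on {0<..<1} (\<lambda>u. f (x * u))" if "x \<in> {0..1}" for x
    using unit[OF that] by (intro continuous_on_compose2[OF cont]) (auto intro!: continuous_intros)
  have "continuous_on {0..1} (\<lambda>x. frac_int a (\<lambda>u. f (x * u)) 1)"
    unfolding continuous_on_def tendsto_at_iff_sequentially comp_def
  proof (intro ballI allI impI)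
    fix x :: real and X :: "nat \<Rightarrow> real"
    assume x: "x \<in> {0..1}" and X: "\<forall>i. X i \<in> {0..1} - {x}" "X \<longlonglongrightarrow> x"
    then have X1: "X i \<in> {0..1}" for i by auto
    show "(\<lambda>i. frac_int a (\<lambda>u. f (X i * u)) 1) \<longlonglongrightarrow> frac_int a (\<lambda>u. f (x * u)) 1"
    proof (rule frac_int_one_tendsto[OF a contx[OF X1] contx[OF x]])
      show "\<bar>f (X i * u)\<bar> \<le> M" if "u \<in> {0<..<1}" for i u
        by (rule M[OF unit[OF X1 that]])
      show "(\<lambda>i. f (X i * u)) \<longlonglongrightarrow> f (x * u)" if u: "u \<in> {0<..<1}" for u
      proof (rule continuous_on_tendsto_compose[OF cont _ unit[OF x u]])
        show "(\<lambda>i. X i * u) \<longlonglongrightarrow> x * u" by (intro tendsto_intros X(2))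
      qed (use unit[OF X1 u] in simp)
    qed
  qed
  then have "continuous_on {0..1} (\<lambda>x. x powr a * frac_int a (\<lambda>u. f (x * u)) 1)"
    using a by (intro continuous_on_mult continuous_on_powr' continuous_intros) auto
  then show ?thesis
    by (subst continuous_on_cong[OF refl]) (use a in \<open>auto intro!: frac_int_dilation\<close>)
qed

lemma frac_int_1_eq_integral:
  assumes cont: "continuous_on {0..1} f" and x: "x \<in> {0..1}"
  shows "frac_int 1 f x = integral {0..x} f"
proof -
  obtain M where [measurable]: "(\<lambda>t. indicator {0..1} t * f t) \<in> borel_measurable borel"
    using bounded_measurable_of_continuous_on_unit[OF cont] by metis
  have contx: "continuous_on {0..x} f"
    by (rule continuous_on_subset[OF cont]) (use x in auto)
  have [measurable]: "(\<lambda>t. indicator {0..x} t *\<^sub>R f t) \<in> borel_measurable borel"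
    by (rule borel_measurable_continuous_on_indicator[OF _ contx]) simp
  have "AE t in lborel. t \<noteq> x" by (rule AE_lborel_singleton)
  then have "AE t in lborel. abel_kernel 1 (x - t) * (indicator {0..1} t * f t) = indicator {0..x} t *\<^sub>R f t"
    by eventually_elim (use x in \<open>auto simp: abel_kernel_one indicator_def\<close>)
  then have "frac_int 1 f x = (\<integral>t. indicator {0..x} t *\<^sub>R f t \<partial>lborel)"
    unfolding frac_int_def by (intro integral_cong_AE) measurable
  also have "\<dots> = integral {0..x} f"
    using set_borel_integral_eq_integral(2)[OF borel_integrable_atLeastAtMost'[OF contx]]
    by (simp add: set_lebesgue_integral_def)
  finally show ?thesis .
qed

lemma frac_int_1_deriv:
  assumes cont: "continuous_on {0..1} f" and x: "x \<in> {0..1}"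
  shows "(frac_int 1 f has_real_derivative f x) (at x within {0..1})"
  by (rule has_field_derivative_transform_within[OF integral_has_real_derivative[OF cont x] zero_less_one x])
     (simp add: frac_int_1_eq_integral[OF cont])

lemma at_within_Icc_neq_bot: "x \<in> {0..1} \<Longrightarrow> at x within {0..1::real} \<noteq> bot"
  by (simp add: trivial_limit_within islimpt_Icc)

lemma at_within_Ioc_eq_Icc:
  assumes "x \<in> {0<..1::real}"
  shows "at x within {0<..1} = at x within {0..1}"
  by (rule at_within_nhd[where S="{0<..}"]) (use assms in auto)

lemma at_within_Ioc_neq_bot: "x \<in> {0<..1} \<Longrightarrow> at x within {0<..1::real} \<noteq> bot"
  using at_within_Icc_neq_bot[of x] by (simp add: at_within_Ioc_eq_Icc)

text \<open>
  The fundamental theorem of calculus in the form that suits a Riemann--Liouville derivative,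
  which is given on \<open>(0,1]\<close> only.
\<close>

lemma frac_int_1_of_deriv:
  assumes G0: "g 0 = 0" and contg: "continuous_on {0..1} g"
    and deriv: "\<And>x. x \<in> {0<..1} \<Longrightarrow> (g has_real_derivative g' x) (at x within {0<..1})"
    and cont: "continuous_on {0..1} g'" and x: "x \<in> {0..1}"
  shows "g x = frac_int 1 g' x"
proof -
  have "(g' has_integral (g x - g 0)) {0..x}"
  proof (rule fundamental_theorem_of_calculus_interior)
    show "continuous_on {0..x} g"
      by (rule continuous_on_subset[OF contg]) (use x in auto)
    fix z assume z: "z \<in> {0<..<x}"
    with x have "(g has_real_derivative g' z) (at z within {0<..1})" by (intro deriv) auto
    moreover have "at z within {0<..1} = at z"
      using z x by (intro at_within_interior) auto
    ultimately show "(g has_vector_derivative g' z) (at z)"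
      by (simp add: has_real_derivative_iff_has_vector_derivative)
  qed (use x in auto)
  then show ?thesis
    using frac_int_1_eq_integral[OF cont x] by (simp add: G0 integral_unique)
qed

text \<open>
  If \<open>g\<close> vanishes at \<open>0\<close>, it is the integral \<open>I\<^sup>1 g'\<close> of its derivative, and \<open>I\<^sup>b I\<^sup>1 g' = I\<^sup>1 I\<^sup>b g'\<close> by the semigroup
  law.
\<close>

lemma frac_int_deriv:
  assumes b: "0 < b" and G0: "g 0 = 0"
    and deriv: "\<And>x. x \<in> {0..1} \<Longrightarrow> (g has_real_derivative g' x) (at x within {0..1})"
    and cont: "continuous_on {0..1} g'" and x: "x \<in> {0..1}"
  shows "(frac_int b g has_real_derivative frac_int b g' x) (at x within {0..1})"
proof -
  have contg: "continuous_on {0..1} g" by (rule DERIV_continuous_on[OF deriv])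
  have "g t = frac_int 1 g' t" if "t \<in> {0..1}" for t
    using G0 contg _ cont that
    by (rule frac_int_1_of_deriv) (rule has_field_derivative_subset[OF deriv], auto)
  then have "frac_int b g y = frac_int b (frac_int 1 g') y" for y
    by (rule frac_int_cong)
  then have eq: "frac_int b g y = frac_int 1 (frac_int b g') y" if "y \<in> {0..1}" for y
    using frac_int_semigroup[of b 1 g' y] frac_int_semigroup[of 1 b g' y] b cont that
    by (simp add: add.commute)
  have "(frac_int 1 (frac_int b g') has_real_derivative frac_int b g' x) (at x within {0..1})"
    by (intro frac_int_1_deriv frac_int_continuous b cont x)
  then show ?thesis
    by (rule has_field_derivative_transform_within[OF _ zero_less_one x]) (simp add: eq)
qed

text \<open>
  Applying the fractional integral of order \<open>1 - b\<close> to the equation shows that the two continuous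
  functions \<open>f\<close> and \<open>frac_int (1 - b) y\<close> have the same primitive.
\<close>

lemma abel_inversion:
  assumes b: "0 < b" "b < 1" and contf: "continuous_on {0..1} f" and conty: "continuous_on {0..1} y"
    and eq: "\<And>x. x \<in> {0..1} \<Longrightarrow> frac_int b f x = frac_int 1 y x"
    and x: "x \<in> {0..1}"
  shows "f x = frac_int (1 - b) y x"
proof -
  define a where "a = 1 - b"
  have a: "0 < a" and ab: "a + b = 1" using b by (auto simp: a_def)
  have prim: "frac_int 1 f z = frac_int 1 (frac_int a y) z" if z: "z \<in> {0..1}" for z
  proof -
    have "frac_int 1 f z = frac_int a (frac_int b f) z"
      using frac_int_semigroup[OF a b(1) contf] z ab by simp
    also have "\<dots> = frac_int a (frac_int 1 y) z"
      by (rule frac_int_cong) (rule eq)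
    also have "\<dots> = frac_int 1 (frac_int a y) z"
      using frac_int_semigroup[of a 1 y z] frac_int_semigroup[of 1 a y z] a conty z
      by (simp add: add.commute)
    finally show ?thesis .
  qed
  have "(frac_int 1 (frac_int a y) has_real_derivative f x) (at x within {0..1})"
    by (rule has_field_derivative_transform_within[OF frac_int_1_deriv[OF contf x] zero_less_one x])
       (rule prim)
  moreover have "(frac_int 1 (frac_int a y) has_real_derivative frac_int a y x) (at x within {0..1})"
    by (intro frac_int_1_deriv frac_int_continuous a conty x)
  ultimately show ?thesis
    unfolding a_def has_real_derivative_iff_has_vector_derivative
    by (rule vector_derivative_unique_within[OF at_within_Icc_neq_bot[OF x]])
qed

section \<open>Regularity from the Caputo derivative\<close>

lemma RL_integral_eq_frac_int:
  assumes b: "\<sigma> < real m" and cont: "continuous_on {0..1} g" and x: "x \<le> 1"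
  shows "RL_integral m \<sigma> g x = frac_int (real m - \<sigma>) g x"
proof -
  define b where "b = real m - \<sigma>"
  have pos: "0 < Gamma b" using b by (simp add: b_def Gamma_real_pos)
  obtain M where [measurable]: "(\<lambda>t. indicator {0..1} t * g t) \<in> borel_measurable borel"
    using bounded_measurable_of_continuous_on_unit[OF cont] by metis
  have "indicator {0..x} t *\<^sub>R ((x - t) powr (b - 1) * g t)
      = Gamma b * (abel_kernel b (x - t) * (indicator {0..1} t * g t))" for t
    using x pos by (auto simp: abel_kernel_def indicator_def)
  note eq = this
  have "(LINT t:{0..x}|lebesgue. (x - t) powr (b - 1) * g t)
      = (\<integral>t. Gamma b * (abel_kernel b (x - t) * (indicator {0..1} t * g t)) \<partial>lebesgue)"
    by (simp only: set_lebesgue_integral_def eq)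
  also have "\<dots> = (\<integral>t. Gamma b * (abel_kernel b (x - t) * (indicator {0..1} t * g t)) \<partial>lborel)"
    by (rule integral_completion) measurable
  also have "\<dots> = Gamma b * frac_int b g x"
    by (simp add: frac_int_def)
  finally show ?thesis
    using pos by (simp add: RL_integral_def b_def)
qed

lemma taylor_sum_deriv:
  fixes c :: "nat \<Rightarrow> real"
  shows "((\<lambda>x. \<Sum>j\<le>Suc N. c j / fact j * x ^ j) has_real_derivative
     (\<Sum>j\<le>N. c (Suc j) / fact j * x ^ j)) (at x within S)"
proof -
  have "((\<lambda>x. \<Sum>j\<le>Suc N. c j / fact j * x ^ j) has_real_derivative
     (\<Sum>j\<le>Suc N. c j / fact j * (real j * x ^ (j - Suc 0)))) (at x within S)"
    by (intro DERIV_sum DERIV_cmult DERIV_pow)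
  also have "(\<Sum>j\<le>Suc N. c j / fact j * (real j * x ^ (j - Suc 0)))
      = (\<Sum>j\<le>N. c (Suc j) / fact j * x ^ j)"
    unfolding sum.atMost_Suc_shift by (simp del: of_nat_Suc)
  finally show ?thesis .
qed

text \<open>
  For \<open>0 < \<nu> < 1\<close> and \<open>i \<ge> 1\<close> only the third case \<open>i > 1 - \<nu>\<close> of the weight occurs, and
  \<open>x powr (1 - \<nu> - i) \<le> x powr (- i)\<close> because \<open>x \<le> 1\<close>.
\<close>

lemma weighted_C_smooth_order:
  assumes y: "y \<in> weighted_C q \<nu>" and nu: "0 < \<nu>" "\<nu> < 1"
  shows "smooth_order q 0 y"
  unfolding smooth_order_iff_tower
proof (intro exI[of _ "\<lambda>k. nth_deriv_on k {0<..1} y"] conjI allI impI ballI)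
  from y have C: "y \<in> C_on q {0<..1}" and cont: "continuous_on {0..1} y"
    by (auto simp: weighted_C_def)
  obtain K where K: "\<And>x i. x \<in> {0<..1} \<Longrightarrow> i \<in> {1..q} \<Longrightarrow> \<bar>nth_deriv_on i {0<..1} y x\<bar> \<le>
     (if real i < 1 - \<nu> then K else if real i = 1 - \<nu> then K * (1 + \<bar>ln x\<bar>) else K * x powr (1 - \<nu> - real i))"
    using y unfolding weighted_C_def by blast
  obtain M where M: "\<And>t. t \<in> {0..1} \<Longrightarrow> \<bar>y t\<bar> \<le> M"
    using bounded_measurable_of_continuous_on_unit[OF cont] by metis
  show "continuous_on {0<..1} (nth_deriv_on q {0<..1} y)"
    using C by (simp add: C_on_def)
  show "(nth_deriv_on k {0<..1} y has_real_derivative nth_deriv_on (Suc k) {0<..1} y x) (at x within {0<..1})"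
    if "k < q" "x \<in> {0<..1}" for k x
    using C that by (intro times_differentiable_onD[of q]) (auto simp: C_on_def)
  show "\<exists>C. \<forall>x\<in>{0<..1}. \<bar>nth_deriv_on k {0<..1} y x\<bar> \<le> C * x powr (0 - real k)" if k: "k \<le> q" for k
  proof (cases "k = 0")
    case True
    then show ?thesis using M by (intro exI[of _ M]) auto
  next
    case False
    show ?thesis
    proof (intro exI[of _ "\<bar>K\<bar>"] ballI)
      fix x :: real assume x: "x \<in> {0<..1}"
      have "\<bar>nth_deriv_on k {0<..1} y x\<bar> \<le> K * x powr (1 - \<nu> - real k)"
        using K[OF x, of k] False k nu by simp
      also have "\<dots> \<le> \<bar>K\<bar> * x powr (1 - \<nu> - real k)"
        by (intro mult_right_mono) auto
      also have "\<dots> \<le> \<bar>K\<bar> * x powr (0 - real k)"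
        using x nu by (intro mult_left_mono powr_mono') auto
      finally show "\<bar>nth_deriv_on k {0<..1} y x\<bar> \<le> \<bar>K\<bar> * x powr (0 - real k)" .
    qed
  qed
qed simp

theorem theorem3p2:
  fixes m q :: nat and \<sigma> :: real and r :: "real \<Rightarrow> real"
  assumes "m \<ge> 1"
    and "real m - 1 < \<sigma>" and "\<sigma> < real m"
    and "q \<ge> 1"
    and "r \<in> C_on (m - 1) {0..1}"
    and "caputo_deriv_exists m \<sigma> r"
    and "extends_to_weighted_C q (real m - \<sigma>) (caputo_deriv m \<sigma> r)"
  shows "r \<in> C_on (q + m - 1) {0<..1} \<and>
    (\<exists>C. \<forall>x\<in>{0<..1}. \<forall>i\<le>q + m - 1.
       \<bar>nth_deriv_on i {0<..1} r x\<bar> \<le> (if i \<le> m - 1 then C else C * x powr (\<sigma> - real i)))"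
proof -
  define n where "n = m - 1"
  define b where "b = real m - \<sigma>"
  have m: "m = Suc n" using assms(1) by (simp add: n_def)
  have b: "0 < b" "b < 1" using assms(2,3) by (auto simp: b_def)
  have sigma: "1 - b = \<sigma> - real n" by (simp add: b_def m)
  define R where "R k = nth_deriv_on k {0..1} r" for k
  \<comment> \<open>\<open>P k\<close> is the \<open>k\<close>-th derivative of the Taylor polynomial \<open>P 0\<close>, so \<open>g k\<close> is that of \<open>r - P 0\<close>.\<close>
  define P where "P k x = (\<Sum>j\<le>n - k. R (k + j) 0 / fact j * x ^ j)" for k and x :: real
  define g where "g k x = R k x - P k x" for k x
  have r: "r \<in> C_on n {0..1}" using assms(5) by (simp add: n_def)
  have R_deriv: "(R k has_real_derivative R (Suc k) x) (at x within {0..1})"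
    if "k < n" "x \<in> {0..1}" for k x
    unfolding R_def using r that by (intro times_differentiable_onD[of n]) (auto simp: C_on_def)
  have R_cont: "continuous_on {0..1} (R k)" if "k \<le> n" for k
    unfolding R_def using r that by (auto simp: C_on_def)
  have P_deriv: "(P k has_real_derivative P (Suc k) x) (at x within S)" if "k < n" for k x S
    using taylor_sum_deriv[of "\<lambda>j. R (k + j) 0" "n - Suc k" x S] that
    by (simp add: P_def[abs_def] Suc_diff_Suc)
  have P_0: "P k 0 = R k 0" if "k \<le> n" for k
  proof -
    have "P k 0 = (\<Sum>j\<in>{0}. R (k + j) 0 / fact j * 0 ^ j)"
      unfolding P_def by (rule sum.mono_neutral_right) auto
    then show ?thesis by simp
  qed
  have P_n: "P n x = R n 0" for x by (simp add: P_def)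
  have P_cont: "continuous_on {0..1} (P k)" for k
    unfolding P_def[abs_def] by (intro continuous_intros)
  have g_deriv: "(g k has_real_derivative g (Suc k) x) (at x within {0..1})"
    if "k < n" "x \<in> {0..1}" for k x
    unfolding g_def[abs_def] by (intro DERIV_diff R_deriv P_deriv that)
  have g_cont: "continuous_on {0..1} (g k)" if "k \<le> n" for k
    unfolding g_def[abs_def] by (intro continuous_on_diff R_cont P_cont that)
  have g_0: "g k 0 = 0" if "k \<le> n" for k
    using P_0[OF that] by (simp add: g_def)
  have g_taylor: "(\<lambda>t. r t - taylor_poly_at_0 (m - 1) r t) = g 0"
    by (simp add: fun_eq_iff g_def R_def P_def taylor_poly_at_0_def n_def)

  \<comment> \<open>Moving \<open>n\<close> of the \<open>m = n + 1\<close> derivatives inside the fractional integral of \<open>g 0\<close>.\<close>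
  define F where "F = RL_integral m \<sigma> (g 0)"
  have F_eq: "F x = frac_int b (g 0) x" if "x \<in> {0<..1}" for x
    unfolding F_def b_def using that by (intro RL_integral_eq_frac_int assms(3) g_cont) auto
  have F_n: "nth_deriv_on n {0<..1} F x = frac_int b (g n) x" if "x \<in> {0<..1}" for x
  proof (rule derivative_tower_nth_deriv_on[where D="\<lambda>k. frac_int b (g k)" and n=n])
    fix k and z :: real assume "k < n" "z \<in> {0<..1}"
    then have "(frac_int b (g k) has_real_derivative frac_int b (g (Suc k)) z) (at z within {0..1})"
      by (intro frac_int_deriv b g_0 g_deriv g_cont) auto
    then show "(frac_int b (g k) has_real_derivative frac_int b (g (Suc k)) z) (at z within {0<..1})"
      by (rule has_field_derivative_subset) auto
  qed (use that at_within_Ioc_neq_bot F_eq in simp_all)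
  obtain y where y: "y \<in> weighted_C q b" "\<And>x. x \<in> {0<..1} \<Longrightarrow> y x = caputo_deriv m \<sigma> r x"
    using assms(7) by (auto simp: extends_to_weighted_C_def b_def)
  have y_cont: "continuous_on {0..1} y" using y(1) by (simp add: weighted_C_def)
  have y_eq: "y x = nth_deriv_on (Suc n) {0<..1} F x" if "x \<in> {0<..1}" for x
    using y(2)[OF that] unfolding caputo_deriv_def g_taylor RL_deriv_def F_def by (simp only: m)
  have F_diff: "times_differentiable_on (Suc n) F {0<..1}"
    using assms(6) unfolding caputo_deriv_exists_def g_taylor RL_deriv_exists_def F_def by (simp only: m)
  have "(frac_int b (g n) has_real_derivative y x) (at x within {0<..1})" if x: "x \<in> {0<..1}" for x
    unfolding y_eq[OF x]
    by (rule has_field_derivative_transform_within[OF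
          times_differentiable_onD[OF F_diff lessI x] zero_less_one x]) (rule F_n)
  then have "frac_int b (g n) x = frac_int 1 y x" if "x \<in> {0..1}" for x
    using that by (intro frac_int_1_of_deriv frac_int_nonpos frac_int_continuous b g_cont y_cont) auto
  \<comment> \<open>Solving this Abel equation for \<open>g n\<close>, which is \<open>R n\<close> up to a constant.\<close>
  then have h_eq: "g n x = frac_int (1 - b) y x" if "x \<in> {0..1}" for x
    using that by (intro abel_inversion b g_cont y_cont) auto
  have "smooth_order q (1 - b) (frac_int (1 - b) y)"
    using b by (intro smooth_order_frac_int weighted_C_smooth_order[OF y(1)]) auto
  then have "smooth_order q (1 - b) (g n)"
    by (rule smooth_order_cong) (simp add: h_eq)
  then obtain D where D0: "D 0 = g n" and D_cont: "continuous_on {0<..1} (D q)"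
    and D_deriv: "\<And>k x. k < q \<Longrightarrow> x \<in> {0<..1} \<Longrightarrow> (D k has_real_derivative D (Suc k) x) (at x within {0<..1})"
    and D_bound: "\<And>k. k \<le> q \<Longrightarrow> \<exists>C. \<forall>x\<in>{0<..1}. \<bar>D k x\<bar> \<le> C * x powr (1 - b - real k)"
    unfolding smooth_order_iff_tower by blast

  \<comment> \<open>\<open>D\<close> takes over after \<open>R n\<close> at \<open>D 1\<close>, where the constant in \<open>R n = g n + R n 0\<close> has disappeared.\<close>
  define E where "E k = (if k \<le> n then R k else D (k - n))" for k
  have E_deriv: "(E k has_real_derivative E (Suc k) x) (at x within {0<..1})"
    if k: "k < q + n" and x: "x \<in> {0<..1}" for k x
  proof -
    consider "k < n" | "k = n" | "n < k" by linarith
    then show ?thesis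
    proof cases
      case 1
      with x have "(R k has_real_derivative R (Suc k) x) (at x within {0<..1})"
        by (intro has_field_derivative_subset[OF R_deriv]) auto
      with 1 show ?thesis by (simp add: E_def)
    next
      case 2
      have "R n = (\<lambda>x. g n x + R n 0)" by (simp add: g_def P_n fun_eq_iff)
      moreover have "((\<lambda>x. g n x + R n 0) has_real_derivative D 1 x + 0) (at x within {0<..1})"
        using D_deriv[of 0 x] k x 2 D0 by (intro DERIV_add) auto
      ultimately have "(R n has_real_derivative D 1 x) (at x within {0<..1})" by simp
      with 2 show ?thesis by (simp add: E_def)
    next
      case 3
      with k x show ?thesis
        using D_deriv[of "k - n" x] by (simp add: E_def Suc_diff_le)
    qed
  qed
  have E_cont: "continuous_on {0<..1} (E (q + n))"
    using assms(4) D_cont by (simp add: E_def)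
  have qm: "q + m - 1 = q + n" by (simp add: m)
  have E_0: "E 0 = r" by (simp add: E_def R_def)
  have "r \<in> C_on (q + n) {0<..1}"
    by (rule derivative_tower_C_on[where D=E]) (use at_within_Ioc_neq_bot E_deriv E_cont E_0 in auto)
  moreover have "\<exists>C. \<forall>x\<in>{0<..1}. \<forall>i\<le>q + n.
       \<bar>nth_deriv_on i {0<..1} r x\<bar> \<le> (if i \<le> n then C else C * x powr (\<sigma> - real i))"
  proof -
    have "\<exists>C. \<forall>x\<in>{0<..1}. \<bar>E i x\<bar> \<le> (if i \<le> n then C else C * x powr (\<sigma> - real i))"
      if i: "i \<le> q + n" for i
    proof (cases "i \<le> n")
      case True
      obtain M where "\<And>t. t \<in> {0..1} \<Longrightarrow> \<bar>R i t\<bar> \<le> M"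
        using bounded_measurable_of_continuous_on_unit[OF R_cont[OF True]] by metis
      with True show ?thesis by (intro exI[of _ M]) (auto simp: E_def)
    next
      case False
      have "i - n \<le> q" using i by simp
      from D_bound[OF this] obtain C
        where "\<forall>x\<in>{0<..1}. \<bar>D (i - n) x\<bar> \<le> C * x powr (1 - b - real (i - n))" ..
      moreover have "1 - b - real (i - n) = \<sigma> - real i"
        using False by (simp add: sigma of_nat_diff)
      ultimately have "\<forall>x\<in>{0<..1}. \<bar>D (i - n) x\<bar> \<le> C * x powr (\<sigma> - real i)"
        by (simp only:)
      then show ?thesis
        using False by (intro exI[of _ C]) (simp add: E_def)
    qed
    then have "\<exists>K. \<forall>i\<in>{..q + n}. \<forall>x\<in>{0<..1}.
        \<bar>E i x\<bar> \<le> (if i \<le> n then K i else K i * x powr (\<sigma> - real i))"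
      by (intro bchoice) simp
    then obtain K where "\<forall>i\<in>{..q + n}. \<forall>x\<in>{0<..1}.
        \<bar>E i x\<bar> \<le> (if i \<le> n then K i else K i * x powr (\<sigma> - real i))" ..
    then have K: "\<bar>E i x\<bar> \<le> (if i \<le> n then K i else K i * x powr (\<sigma> - real i))"
      if "i \<le> q + n" "x \<in> {0<..1}" for i x
      using that by simp
    show ?thesis
    proof (intro exI[of _ "\<Sum>i\<le>q + n. \<bar>K i\<bar>"] ballI allI impI)
      fix x :: real and i assume x: "x \<in> {0<..1}" and i: "i \<le> q + n"
      have "K i \<le> \<bar>K i\<bar>" by simp
      also have "\<bar>K i\<bar> \<le> (\<Sum>i\<le>q + n. \<bar>K i\<bar>)"
        using i by (intro member_le_sum) auto
      finally have Ki: "K i \<le> (\<Sum>i\<le>q + n. \<bar>K i\<bar>)" .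
      have "nth_deriv_on i {0<..1} r x = E i x"
        by (rule derivative_tower_nth_deriv_on[where D=E and n="q + n"])
           (use at_within_Ioc_neq_bot E_deriv E_0 x i in auto)
      moreover have "K i * x powr (\<sigma> - real i) \<le> (\<Sum>i\<le>q + n. \<bar>K i\<bar>) * x powr (\<sigma> - real i)"
        using Ki by (intro mult_right_mono) simp_all
      ultimately show "\<bar>nth_deriv_on i {0<..1} r x\<bar>
          \<le> (if i \<le> n then \<Sum>i\<le>q + n. \<bar>K i\<bar> else (\<Sum>i\<le>q + n. \<bar>K i\<bar>) * x powr (\<sigma> - real i))"
        using K[OF i x] Ki by (auto split: if_splits)
    qed
  qed
  ultimately show ?thesis
    unfolding qm by (simp add: m)
qed

end
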